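(* Let $i=i(d)$ satisfy $i=o(d)$, and let $G$ be a subgraph of $Q_d$ with $n=O\left(\left|[d]^{(\le i)}\right|\right)$ vertices. Then $\lambda_1(G)\le (1+o(1))\,\lambda_1(H_d^i)$, where $o(1)\to 0$ as $d\to\infty$.
   Context: $Q_d$ is the $d$-dimensional hypercube with vertex set the subsets of $[d]=\{1,\dots,d\}$, two vertices adjacent iff their symmetric difference has size one. $[d]^{(\le i)}$ denotes the family of subsets of $[d]$ of size at most $i$. The Hamming ball $H_d^i$ is the subgraph of $Q_d$ induced by $[d]^{(\le i)}$. $\lambda_1(G)$ denotes the largest eigenvalue of the adjacency matrix of $G$.
   Formalization: The formal statement assumes i(d) ≥ 1 for all large d (for i = 0 the claim fails: a single edge has 2 = O(1) vertices and λ₁ = 1, but λ₁(H_d^0) = 0), and takes G to be non-empty so that λ₁(G) is defined. *)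

theory Defs
  imports
    Complex_Main
    "HOL-Library.Landau_Symbols"
    "Graph_Theory.Graph_Theory"
    "Jordan_Normal_Form.Char_Poly"
begin

text \<open>
  A finite simple graph is a \<^locale>\<open>pair_graph\<close>: a finite, loop-free digraph without parallel
  arcs whose arc relation is symmetric, so that each undirected edge is a pair of opposite arcs.
\<close>

definition small_subsets :: "nat \<Rightarrow> nat \<Rightarrow> nat set set" where
  "small_subsets d i = {A. A \<subseteq> {1..d} \<and> card A \<le> i}"

definition hypercube :: "nat \<Rightarrow> nat set pair_pre_digraph" where
  "hypercube d = \<lparr> pverts = Pow {1..d},
     parcs = {(A, B). A \<subseteq> {1..d} \<and> B \<subseteq> {1..d} \<and> card (sym_diff A B) = 1} \<rparr>"

definition hamming_ball :: "nat \<Rightarrow> nat \<Rightarrow> nat set pair_pre_digraph" where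
  "hamming_ball d i = \<lparr> pverts = small_subsets d i,
     parcs = {(A, B) \<in> parcs (hypercube d). A \<in> small_subsets d i \<and> B \<in> small_subsets d i} \<rparr>"

text \<open>Rows and columns are ordered by a list enumerating the vertices.\<close>

definition adj_matrix :: "'a pair_pre_digraph \<Rightarrow> 'a list \<Rightarrow> real mat" where
  "adj_matrix G vs =
     mat (length vs) (length vs) (\<lambda>(r, c). if (vs ! r, vs ! c) \<in> parcs G then 1 else 0)"

text \<open>
  The enumeration is irrelevant, see \<open>lambda1_eq\<close> below. The value is unspecified for the graph
  without vertices, which has no eigenvalue.
\<close>

definition lambda1 :: "'a pair_pre_digraph \<Rightarrow> real" where
  "lambda1 G =
     Max {k. eigenvalue (adj_matrix G (SOME vs. distinct vs \<and> set vs = pverts G)) k}"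

lemma pair_graph_hypercube: "pair_graph (hypercube d)"
proof
  show "finite (parcs (hypercube d))"
    by (rule finite_subset[of _ "Pow {1..d} \<times> Pow {1..d}"]) (auto simp: hypercube_def)
  show "symmetric (hypercube d)"
    by (auto simp: hypercube_def symmetric_def sym_def Un_commute)
qed (auto simp: hypercube_def)

lemma pair_graph_hamming_ball: "pair_graph (hamming_ball d i)"
proof
  show "finite (pverts (hamming_ball d i))"
    by (rule finite_subset[of _ "Pow {1..d}"]) (auto simp: hamming_ball_def small_subsets_def)
  show "finite (parcs (hamming_ball d i))"
    by (rule finite_subset[of _ "Pow {1..d} \<times> Pow {1..d}"])
      (auto simp: hamming_ball_def small_subsets_def)
  show "symmetric (hamming_ball d i)"
    by (auto simp: hamming_ball_def hypercube_def symmetric_def sym_def Un_commute)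
qed (auto simp: hamming_ball_def hypercube_def)

lemma induced_subgraph_hamming_ball:
  "induced_subgraph (with_proj (hamming_ball d i)) (with_proj (hypercube d))"
proof -
  interpret Q: pair_graph "hypercube d" by (rule pair_graph_hypercube)
  interpret H: pair_graph "hamming_ball d i" by (rule pair_graph_hamming_ball)
  have "subgraph (with_proj (hamming_ball d i)) (with_proj (hypercube d))"
    unfolding subgraph_def compatible_def
    using Q.wf_digraph H.wf_digraph
    by (auto simp: hamming_ball_def hypercube_def small_subsets_def)
  then show ?thesis
    unfolding induced_subgraph_def by (auto simp: hamming_ball_def)
qed

lemma eigenvalue_adj_matrix_iff:
  assumes "distinct vs" and "set vs = pverts G"
  shows "eigenvalue (adj_matrix G vs) k \<longleftrightarrow>
    (\<exists>f. (\<exists>u\<in>pverts G. f u \<noteq> 0) \<and>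
         (\<forall>u\<in>pverts G. (\<Sum>w | w \<in> pverts G \<and> (u, w) \<in> parcs G. f w) = k * f u))"
    (is "_ \<longleftrightarrow> ?R")
proof -
  let ?n = "length vs"
  have fin: "finite (pverts G)" using assms(2) by (metis List.finite_set)
  have mul: "(adj_matrix G vs *\<^sub>v x) $ r
      = (\<Sum>w | w \<in> pverts G \<and> (vs ! r, w) \<in> parcs G. f w)"
    if x: "x \<in> carrier_vec ?n" and xf: "\<And>c. c < ?n \<Longrightarrow> x $ c = f (vs ! c)" and r: "r < ?n"
    for x f r
  proof -
    have bij: "bij_betw ((!) vs) {..<?n} (pverts G)"
      by (rule bij_betw_nth[OF assms(1) refl assms(2)[symmetric]])
    have "(adj_matrix G vs *\<^sub>v x) $ r
        = (\<Sum>c<?n. (if (vs ! r, vs ! c) \<in> parcs G then 1 else 0) * x $ c)"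
      using x r by (simp add: adj_matrix_def scalar_prod_def atLeast0LessThan)
    also have "\<dots> = (\<Sum>c<?n. if (vs ! r, vs ! c) \<in> parcs G then f (vs ! c) else 0)"
      by (rule sum.cong) (simp_all add: xf)
    also have "\<dots> = (\<Sum>w\<in>pverts G. if (vs ! r, w) \<in> parcs G then f w else 0)"
      by (rule sum.reindex_bij_betw[OF bij])
    also have "\<dots> = (\<Sum>w | w \<in> pverts G \<and> (vs ! r, w) \<in> parcs G. f w)"
      using fin by (simp add: sum.inter_filter)
    finally show ?thesis .
  qed
  have dim: "dim_row (adj_matrix G vs) = ?n" by (simp add: adj_matrix_def)
  show ?thesis
  proof
    assume "eigenvalue (adj_matrix G vs) k"
    then obtain x where x: "x \<in> carrier_vec ?n" "x \<noteq> 0\<^sub>v ?n" "adj_matrix G vs *\<^sub>v x = k \<cdot>\<^sub>v x"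
      by (auto simp: eigenvalue_def eigenvector_def dim)
    define f where "f w = x $ (inv_into {..<?n} ((!) vs) w)" for w
    have bij: "bij_betw ((!) vs) {..<?n} (pverts G)"
      using assms by (auto intro: bij_betw_nth)
    have f: "x $ c = f (vs ! c)" if "c < ?n" for c
      using that bij by (simp add: f_def bij_betw_def inv_into_f_f)
    obtain c where c: "c < ?n" "x $ c \<noteq> 0"
      using x(1,2) by (auto simp: vec_eq_iff)
    have "\<exists>u\<in>pverts G. f u \<noteq> 0"
      using c f[OF c(1)] assms(2) by auto
    moreover have "(\<Sum>w | w \<in> pverts G \<and> (u, w) \<in> parcs G. f w) = k * f u"
      if u: "u \<in> pverts G" for u
    proof -
      obtain r where r: "r < ?n" "u = vs ! r" using u assms(2) by (metis in_set_conv_nth)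
      show ?thesis using mul[OF x(1) f r(1)] x(1,3) f r by simp
    qed
    ultimately show ?R by blast
  next
    assume ?R
    then obtain f u where u: "u \<in> pverts G" "f u \<noteq> 0"
      and f: "\<And>u. u \<in> pverts G \<Longrightarrow> (\<Sum>w | w \<in> pverts G \<and> (u, w) \<in> parcs G. f w) = k * f u"
      by blast
    define x where "x = vec ?n (\<lambda>c. f (vs ! c))"
    obtain r where r: "r < ?n" "u = vs ! r" using u assms(2) by (metis in_set_conv_nth)
    have x: "x \<in> carrier_vec ?n" by (simp add: x_def)
    have "x $ r \<noteq> 0" using r u by (simp add: x_def)
    then have "x \<noteq> 0\<^sub>v ?n" using r by auto
    moreover have "adj_matrix G vs *\<^sub>v x = k \<cdot>\<^sub>v x"
    proof (rule eq_vecI)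
      fix s assume "s < dim_vec (k \<cdot>\<^sub>v x)"
      then have s: "s < ?n" using x by simp
      have "vs ! s \<in> pverts G" using nth_mem[OF s] assms(2) by simp
      moreover have "(adj_matrix G vs *\<^sub>v x) $ s
          = (\<Sum>w | w \<in> pverts G \<and> (vs ! s, w) \<in> parcs G. f w)"
        by (rule mul[OF x _ s]) (simp add: x_def)
      ultimately show "(adj_matrix G vs *\<^sub>v x) $ s = (k \<cdot>\<^sub>v x) $ s"
        using s f by (simp add: x_def)
    qed (simp add: x_def dim)
    ultimately show "eigenvalue (adj_matrix G vs) k"
      using x by (auto simp: eigenvalue_def eigenvector_def dim)
  qed
qed

lemma lambda1_eq:
  assumes "distinct vs" and "set vs = pverts G"
  shows "lambda1 G = Max {k. eigenvalue (adj_matrix G vs) k}"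
proof -
  let ?ws = "SOME vs. distinct vs \<and> set vs = pverts G"
  have ws: "distinct ?ws \<and> set ?ws = pverts G"
    by (rule someI[of _ vs]) (use assms in blast)
  have "eigenvalue (adj_matrix G ?ws) k \<longleftrightarrow> eigenvalue (adj_matrix G vs) k" for k
    by (simp only: eigenvalue_adj_matrix_iff[OF conjunct1[OF ws] conjunct2[OF ws]]
        eigenvalue_adj_matrix_iff[OF assms])
  then show ?thesis
    unfolding lambda1_def by presburger
qed

end

theory Submission
  imports Defs "HOL-Analysis.Function_Topology"
begin

text \<open>
  The largest eigenvalue is the maximum of the Rayleigh quotient. Polarizing a nonnegative function
  on the cube with respect to a reflection or a transposition of two coordinates keeps its norm and
  the size of its support and does not decrease the sum of the products over the edges. So it
  suffices to bound the quotient of functions supported on a left-compressed down-set \<open>A\<close> of size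
  \<open>n\<close>. If some member of \<open>A\<close> has \<open>k\<close> elements above \<open>h\<close>, then \<open>A\<close> contains all \<open>k\<close>-subsets of
  \<open>{1..h}\<close>, hence \<open>h choose k \<le> n\<close>.

  Let \<open>s = sqrt (i d)\<close> and cut the directions at \<open>\<theta> s\<close> and at \<open>\<theta>\<^sup>2 d\<close>. The first part contributes at
  most its size \<open>\<theta> s\<close>. In the second part the members of \<open>A\<close> have at most \<open>4 i\<close> elements, and AM-GM on
  the edges gives at most \<open>2 sqrt (4 i \<theta>\<^sup>2 d) = 4 \<theta> s\<close>. In the third part they have at most
  \<open>j = i + i div L\<^sup>2\<close> elements, so it contributes at most the eigenvalue of the Hamming ball of radius
  \<open>j\<close>, which is the ball of radius \<open>i\<close> if \<open>i < L\<^sup>2\<close>, and at most \<open>2 sqrt (j d)\<close>, which is good enough if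
  \<open>i \<ge> L\<^sup>2\<close>: test functions that are constant on each of the outer \<open>L\<close> layers, with equal mass on each,
  show that the eigenvalue of the ball is then at least about \<open>2 s\<close>. All errors are small multiples
  of \<open>s\<close>, which is at most twice the eigenvalue of the ball.
\<close>

section \<open>The Rayleigh quotient\<close>

text \<open>A maximizer of the quadratic form on the unit sphere is an eigenvector, and the maximum
  is its eigenvalue. The sum over \<open>E\<close> counts each undirected edge twice, as the form of
  the adjacency matrix does.\<close>

lemma rayleigh_eigenvector:
  fixes V :: "'a set" and E :: "('a \<times> 'a) set"
  assumes fin: "finite V" and ne: "V \<noteq> {}" and EV: "E \<subseteq> V \<times> V" and "sym E"
  obtains k f where "\<exists>u\<in>V. f u \<noteq> (0::real)"
    and "\<And>u. u \<in> V \<Longrightarrow> (\<Sum>w | w \<in> V \<and> (u, w) \<in> E. f w) = k * f u"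
    and "\<And>g. (\<Sum>(u, w)\<in>E. g u * g w) \<le> k * (\<Sum>u\<in>V. (g u)\<^sup>2)"
proof -
  define Q :: "('a \<Rightarrow> real) \<Rightarrow> real" where "Q g = (\<Sum>(u, w)\<in>E. g u * g w)" for g
  define N :: "('a \<Rightarrow> real) \<Rightarrow> real" where "N g = (\<Sum>u\<in>V. (g u)\<^sup>2)" for g
  have finE: "finite E" using EV fin by (meson finite_SigmaI finite_subset)
  \<comment> \<open>Functions are pinned to 0 outside \<open>V\<close>, so \<open>B\<close> is
    compact by Tychonoff even over an infinite type, and the unit sphere of functions supported on
    \<open>V\<close> is a closed part of it.\<close>
  define B where "B = PiE UNIV (\<lambda>x. if x \<in> V then {-1..1::real} else {0})"
  have contQ: "continuous_on UNIV Q"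
    unfolding Q_def case_prod_unfold by (intro continuous_intros) auto
  have contN: "continuous_on UNIV N"
    unfolding N_def by (intro continuous_intros) auto
  have "compactin (product_topology (\<lambda>_. euclidean) UNIV) B"
    unfolding B_def by (subst compactin_PiE) auto
  then have "compact B" by (simp add: euclidean_product_topology)
  moreover have "closed {f. N f = 1}"
    using contN by (intro closed_Collect_eq) auto
  ultimately have "compact (B \<inter> {f. N f = 1})" by (rule compact_Int_closed)
  moreover have "B \<inter> {f. N f = 1} \<noteq> {}"
  proof -
    obtain v where "v \<in> V" using ne by blast
    then have "(\<lambda>x. if x = v then 1 else 0) \<in> B \<inter> {f. N f = 1}"
      using fin by (auto simp: B_def N_def if_distrib[of "\<lambda>z. z\<^sup>2"] cong: if_cong)
    then show ?thesis by blast
  qed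
  moreover have "continuous_on (B \<inter> {f. N f = 1}) Q"
    using contQ continuous_on_subset by blast
  ultimately obtain f where f: "f \<in> B \<inter> {f. N f = 1}"
    and max: "\<And>g. g \<in> B \<inter> {f. N f = 1} \<Longrightarrow> Q g \<le> Q f"
    using continuous_attains_sup by metis
  define k where "k = Q f"
  have Nf: "N f = 1" using f by simp
  have bound: "Q g \<le> k * N g" for g
  proof (cases "N g = 0")
    case True
    then have "\<forall>u\<in>V. g u = 0" using fin by (simp add: N_def sum_nonneg_eq_0_iff)
    then have "Q g = 0" using EV unfolding Q_def by (intro sum.neutral) auto
    then show ?thesis using True by simp
  next
    case False
    have "N g \<ge> 0" by (simp add: N_def sum_nonneg)
    with False have pos: "N g > 0" by simp
    define h where "h x = (if x \<in> V then g x / sqrt (N g) else 0)" for x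
    have "\<bar>g x\<bar> \<le> sqrt (N g)" if "x \<in> V" for x
      unfolding N_def using that fin member_le_sum[of x V "\<lambda>u. (g u)\<^sup>2"]
      by (simp add: real_le_rsqrt)
    then have "h x \<in> (if x \<in> V then {-1..1} else {0})" for x
      using pos by (simp add: h_def field_simps abs_le_iff) (smt (verit))
    then have "h \<in> B" by (auto simp: B_def)
    moreover have "N h = 1"
    proof -
      have "N h = (\<Sum>u\<in>V. (g u)\<^sup>2 / N g)"
        unfolding N_def[of h] by (rule sum.cong) (use pos in \<open>auto simp: h_def power_divide\<close>)
      also have "\<dots> = N g / N g" unfolding N_def[of g] by (rule sum_divide_distrib[symmetric])
      finally show ?thesis using pos by simp
    qed
    ultimately have "Q h \<le> k" using max k_def by simp
    moreover have "Q h = Q g / N g"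
      unfolding Q_def sum_divide_distrib
      by (rule sum.cong) (use EV pos in \<open>auto simp: h_def\<close>)
    ultimately show ?thesis using pos by (simp add: field_simps)
  qed
  have eqn: "(\<Sum>w | w \<in> V \<and> (u, w) \<in> E. f w) = k * f u" if u: "u \<in> V" for u
  proof -
    define e where "e x = (if x = u then 1 else 0 :: real)" for x
    define r where "r = (\<Sum>w | w \<in> V \<and> (u, w) \<in> E. f w)"
    define c where "c = Q e"
    have r1: "(\<Sum>(x, y)\<in>E. e x * f y) = r"
    proof -
      have "(\<Sum>(x, y)\<in>E. e x * f y) = (\<Sum>(x, y)\<in>E \<inter> {u} \<times> UNIV. f y)"
        using finE by (intro sum.mono_neutral_cong_right) (auto simp: e_def split: if_splits)
      also have "\<dots> = r" unfolding r_def
        by (rule sum.reindex_bij_witness[where i = "\<lambda>w. (u, w)" and j = snd]) (use EV in auto)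
      finally show ?thesis .
    qed
    have r2: "(\<Sum>(x, y)\<in>E. f x * e y) = r"
      unfolding r1[symmetric]
      by (rule sum.reindex_bij_witness[where i = prod.swap and j = prod.swap])
        (use \<open>sym E\<close> in \<open>auto dest: symD\<close>)
    \<comment> \<open>First variation of the maximizer \<open>f\<close> in the direction of the
      indicator of \<open>u\<close>: a quadratic inequality valid for all \<open>t\<close> forces
      its linear coefficient to vanish.\<close>
    have main: "2 * t * (r - k * f u) + t\<^sup>2 * (c - k) \<le> 0" for t
    proof -
      define g where "g x = f x + t * e x" for x
      have "Q g = (\<Sum>(x, y)\<in>E. f x * f y + t * (e x * f y) + t * (f x * e y) + t\<^sup>2 * (e x * e y))"
        unfolding Q_def by (rule sum.cong) (auto simp: g_def algebra_simps power2_eq_square)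
      also have "\<dots> = Q f + t * r + t * r + t\<^sup>2 * c"
        unfolding Q_def c_def r1[symmetric]
        using r1 r2 by (simp add: case_prod_unfold sum.distrib sum_distrib_left[symmetric])
      finally have 1: "Q g = k + 2 * t * r + t\<^sup>2 * c" by (simp add: k_def)
      have "N g = (\<Sum>x\<in>V. (f x)\<^sup>2 + 2 * t * (e x * f x) + t\<^sup>2 * e x)"
        unfolding N_def by (rule sum.cong) (auto simp: g_def e_def algebra_simps power2_eq_square)
      also have "\<dots> = N f + 2 * t * (\<Sum>x\<in>V. e x * f x) + t\<^sup>2 * (\<Sum>x\<in>V. e x)"
        by (simp add: N_def sum.distrib sum_distrib_left[symmetric])
      also have "(\<Sum>x\<in>V. e x * f x) = f u"
        using u fin by (simp add: e_def if_distrib[of "\<lambda>z. z * _"] cong: if_cong)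
      also have "(\<Sum>x\<in>V. e x) = 1"
        using u fin by (simp add: e_def)
      finally have "N g = 1 + 2 * t * f u + t\<^sup>2" using Nf by simp
      then show ?thesis using bound[of g] 1 by (simp add: algebra_simps)
    qed
    define a where "a = r - k * f u"
    \<comment> \<open>With \<open>t = a / b\<close> and \<open>b > \<bar>c - k\<bar>\<close> the
      linear term outweighs the quadratic one, which leaves
      \<open>a * a / b \<le> 0\<close>.\<close>
    define b where "b = \<bar>c - k\<bar> + 1"
    have b: "b > 0" "c - k \<ge> - b" by (auto simp: b_def)
    have "2 * (a / b) * a + (a / b)\<^sup>2 * (c - k) \<le> 0" using main[of "a / b"] unfolding a_def[symmetric] .
    moreover have "(a / b)\<^sup>2 * (c - k) \<ge> (a / b)\<^sup>2 * (- b)"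
      by (rule mult_left_mono) (use b in auto)
    moreover have "(a / b)\<^sup>2 * (- b) = - (a / b) * a"
      using b by (simp add: power2_eq_square)
    ultimately have "a * a / b \<le> 0" by simp
    then have "a = 0" using b by (auto simp: divide_le_0_iff mult_le_0_iff)
    then show ?thesis by (simp add: a_def r_def)
  qed
  have "\<exists>u\<in>V. f u \<noteq> 0"
  proof (rule ccontr)
    assume "\<not> ?thesis"
    then have "N f = 0" by (simp add: N_def)
    then show False using Nf by simp
  qed
  then show ?thesis
    by (rule that[of f k, OF _ eqn bound[unfolded Q_def N_def]])
qed

lemma finite_eigenvalues:
  fixes A :: "'a::field mat"
  assumes "A \<in> carrier_mat n n"
  shows "finite {k. eigenvalue A k}"
proof -
  have "{k. eigenvalue A k} = {k. poly (char_poly A) k = 0}"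
    using eigenvalue_root_char_poly[OF assms] by blast
  moreover have "char_poly A \<noteq> 0"
    using degree_monic_char_poly[OF assms] by auto
  ultimately show ?thesis using poly_roots_finite by auto
qed

text \<open>Each eigenvalue is the Rayleigh quotient of its eigenvector, hence at most the maximum
  of the quotient, which is itself an eigenvalue.\<close>

lemma lambda1_rayleigh:
  fixes G :: "'a pair_pre_digraph"
  assumes "pair_graph G" and ne: "pverts G \<noteq> {}"
  obtains f where "\<exists>u\<in>pverts G. f u \<noteq> 0"
    and "(\<Sum>(u, w)\<in>parcs G. f u * f w) = lambda1 G * (\<Sum>u\<in>pverts G. (f u)\<^sup>2)"
    and "\<And>g. (\<Sum>(u, w)\<in>parcs G. g u * g w) \<le> lambda1 G * (\<Sum>u\<in>pverts G. (g u)\<^sup>2)"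
proof -
  interpret pair_graph G by fact
  obtain vs where vs: "distinct vs" "set vs = pverts G"
    using finite_distinct_list[OF finite_verts] by auto
  have EV: "parcs G \<subseteq> pverts G \<times> pverts G"
    using in_arcsD1 in_arcsD2 by auto
  have symE: "sym (parcs G)"
    using sym_arcs by (simp add: symmetric_def)
  let ?S = "{k. eigenvalue (adj_matrix G vs) k}"
  have fin: "finite ?S"
    by (rule finite_eigenvalues[of _ "length vs"]) (simp add: adj_matrix_def)
  have form: "(\<Sum>(u, w)\<in>parcs G. g u * g w) = l * (\<Sum>u\<in>pverts G. (g u)\<^sup>2)"
    if g: "\<forall>u\<in>pverts G. (\<Sum>w | w \<in> pverts G \<and> (u, w) \<in> parcs G. g w) = l * g u"
    for g :: "'a \<Rightarrow> real" and l
  proof -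
    have "(\<Sum>(u, w)\<in>parcs G. g u * g w)
        = (\<Sum>u\<in>pverts G. \<Sum>w | w \<in> pverts G \<and> (u, w) \<in> parcs G. g u * g w)"
      by (subst sum.Sigma) (use EV in \<open>auto intro!: sum.cong\<close>)
    also have "\<dots> = (\<Sum>u\<in>pverts G. g u * (l * g u))"
      by (intro sum.cong) (auto simp: sum_distrib_left[symmetric] g)
    also have "\<dots> = l * (\<Sum>u\<in>pverts G. (g u)\<^sup>2)"
      by (simp add: sum_distrib_left power2_eq_square algebra_simps)
    finally show ?thesis .
  qed
  show ?thesis
  proof (rule rayleigh_eigenvector[OF finite_verts ne EV symE])
    fix k :: real and f :: "'a \<Rightarrow> real"
    assume f: "\<exists>u\<in>pverts G. f u \<noteq> 0"
      and eqn: "\<And>u. u \<in> pverts G \<Longrightarrow> (\<Sum>w | w \<in> pverts G \<and> (u, w) \<in> parcs G. f w) = k * f u"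
      and ray: "\<And>g. (\<Sum>(u, w)\<in>parcs G. g u * g w) \<le> k * (\<Sum>u\<in>pverts G. (g u)\<^sup>2)"
    have "k \<in> ?S"
      unfolding mem_Collect_eq eigenvalue_adj_matrix_iff[OF vs]
      by (rule exI[of _ f]) (use f eqn in simp)
    moreover have "l \<le> k" if l: "l \<in> ?S" for l
    proof -
      obtain g :: "'a \<Rightarrow> real" where g0: "\<exists>u\<in>pverts G. g u \<noteq> 0"
        and g: "\<forall>u\<in>pverts G. (\<Sum>w | w \<in> pverts G \<and> (u, w) \<in> parcs G. g w) = l * g u"
        using l unfolding mem_Collect_eq eigenvalue_adj_matrix_iff[OF vs] by (elim exE conjE)
      obtain u where u: "u \<in> pverts G" "g u \<noteq> 0" using g0 by blast
      have "l * (\<Sum>u\<in>pverts G. (g u)\<^sup>2) \<le> k * (\<Sum>u\<in>pverts G. (g u)\<^sup>2)"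
        using ray[of g] unfolding form[OF g] .
      moreover have "(\<Sum>u\<in>pverts G. (g u)\<^sup>2) > 0"
        using u by (intro sum_pos2[of _ u]) auto
      ultimately show "l \<le> k" by simp
    qed
    ultimately have "lambda1 G = k"
      unfolding lambda1_eq[OF vs] using fin by (intro Max_eqI) auto
    then show ?thesis using that[of f] f form[of f k] eqn ray by simp
  qed
qed

section \<open>Compression\<close>

definition flip :: "'a \<Rightarrow> 'a set \<Rightarrow> 'a set" where
  "flip a x = (if a \<in> x then x - {a} else insert a x)"

lemma flip_flip [simp]: "flip a (flip a x) = x"
  by (auto simp: flip_def)

lemma flip_neq [simp]: "flip a x \<noteq> x" "x \<noteq> flip a x"
  by (auto simp: flip_def)

lemma in_flip_iff: "b \<in> flip a x \<longleftrightarrow> (if b = a then a \<notin> x else b \<in> x)"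
  by (auto simp: flip_def)

lemma flip_subset: "a \<in> S \<Longrightarrow> flip a x \<subseteq> S \<longleftrightarrow> x \<subseteq> S"
  by (auto simp: flip_def)

lemma flip_commute: "flip a (flip b x) = flip b (flip a x)"
  by (auto simp: set_eq_iff in_flip_iff)

lemma image_flip: "inj f \<Longrightarrow> f ` flip a x = flip (f a) (f ` x)"
  by (auto simp: flip_def inj_def)

lemma parcs_hypercube: "(x, y) \<in> parcs (hypercube d) \<longleftrightarrow> x \<subseteq> {1..d} \<and> (\<exists>a\<in>{1..d}. y = flip a x)"
proof
  assume "(x, y) \<in> parcs (hypercube d)"
  then have *: "x \<subseteq> {1..d}" "y \<subseteq> {1..d}" and "card (sym_diff x y) = 1"
    by (auto simp: hypercube_def)
  then obtain a where a: "sym_diff x y = {a}" by (auto simp: card_1_singleton_iff)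
  have "z \<in> y \<longleftrightarrow> z \<in> flip a x" for z
    using a unfolding set_eq_iff in_flip_iff by (metis Diff_iff Un_iff singletonD singletonI)
  then have "y = flip a x" by blast
  moreover have "a \<in> {1..d}" using a * by blast
  ultimately show "x \<subseteq> {1..d} \<and> (\<exists>a\<in>{1..d}. y = flip a x)" using * by blast
next
  assume "x \<subseteq> {1..d} \<and> (\<exists>a\<in>{1..d}. y = flip a x)"
  then obtain a where *: "x \<subseteq> {1..d}" "a \<in> {1..d}" "y = flip a x" by blast
  then have "sym_diff x y = {a}" by (auto simp: flip_def)
  then show "(x, y) \<in> parcs (hypercube d)"
    using * by (simp add: hypercube_def flip_subset del: Un_Diff_cancel2)
qed

text \<open>An arc is determined by its start and its direction, so arcs correspond to pairs
  \<open>(x, a)\<close>.\<close>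

lemma sum_parcs_hypercube:
  "(\<Sum>(x, y)\<in>parcs (hypercube d). F x y) = (\<Sum>x\<in>Pow {1..d}. \<Sum>a\<in>{1..d}. F x (flip a x))"
proof -
  have inj: "a = b" if "flip a x = flip b x" for a b :: nat and x
    using that by (metis in_flip_iff)
  have "(\<Sum>x\<in>Pow {1..d}. \<Sum>a\<in>{1..d}. F x (flip a x))
      = (\<Sum>(x, a)\<in>Pow {1..d} \<times> {1..d}. F x (flip a x))"
    by (simp add: sum.cartesian_product)
  also have "\<dots> = (\<Sum>(x, y)\<in>(\<lambda>(x, a). (x, flip a x)) ` (Pow {1..d} \<times> {1..d}). F x y)"
    by (subst sum.reindex) (auto simp: inj_on_def case_prod_unfold dest: inj)
  also have "(\<lambda>(x, a). (x, flip a x)) ` (Pow {1..d} \<times> {1..d}) = parcs (hypercube d)"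
    by (force simp: image_iff parcs_hypercube)
  finally show ?thesis by simp
qed

section \<open>Two-point rearrangement along an involution\<close>

lemma sum_involution:
  assumes "\<And>x. x \<in> V \<Longrightarrow> \<phi> x \<in> V" and "\<And>x. \<phi> (\<phi> x) = x"
  shows "(\<Sum>x\<in>V. h (\<phi> x)) = (\<Sum>x\<in>V. h x)"
  by (rule sum.reindex_bij_witness[where i = \<phi> and j = \<phi>]) (use assms in auto)

text \<open>Adding to each sum its image under the involution compares the summands orbit by orbit;
  the doubling treats fixed points and pairs alike.\<close>

lemma sum_involution_mono:
  fixes g h :: "'a \<Rightarrow> real"
  assumes "\<And>x. x \<in> V \<Longrightarrow> \<phi> x \<in> V" and "\<And>x. \<phi> (\<phi> x) = x"
    and "\<And>x. x \<in> V \<Longrightarrow> h x + h (\<phi> x) \<le> g x + g (\<phi> x)"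
  shows "sum h V \<le> sum g V"
proof -
  have "2 * sum h V = (\<Sum>x\<in>V. h x + h (\<phi> x))"
    by (simp only: sum.distrib sum_involution[where V = V and \<phi> = \<phi> and h = h, OF assms(1,2)] mult_2)
  also have "\<dots> \<le> (\<Sum>x\<in>V. g x + g (\<phi> x))" by (rule sum_mono) (rule assms(3))
  also have "\<dots> = 2 * sum g V"
    by (simp only: sum.distrib sum_involution[where V = V and \<phi> = \<phi> and h = g, OF assms(1,2)] mult_2)
  finally show ?thesis by simp
qed

text \<open>On each pair \<open>x\<close>, \<open>\<phi> x\<close> the larger value goes to the half
  where \<open>P\<close> holds; at fixed points nothing changes.\<close>

definition polarize :: "('a \<Rightarrow> 'a) \<Rightarrow> ('a \<Rightarrow> bool) \<Rightarrow> ('a \<Rightarrow> real) \<Rightarrow> 'a \<Rightarrow> real" where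
  "polarize \<phi> P f x = (if P x then max (f x) (f (\<phi> x)) else min (f x) (f (\<phi> x)))"

text \<open>\<open>P\<close> selects one point of each exchanged pair and is arbitrary at fixed
  points.\<close>

locale polarization =
  fixes \<phi> :: "'a \<Rightarrow> 'a" and P :: "'a \<Rightarrow> bool" and V :: "'a set"
  assumes invol [simp]: "\<phi> (\<phi> x) = x"
    and closed: "x \<in> V \<Longrightarrow> \<phi> x \<in> V"
    and halves: "\<phi> x \<noteq> x \<Longrightarrow> P (\<phi> x) \<longleftrightarrow> \<not> P x"
    and finV: "finite V"
begin

lemma polarize_cases:
  obtains "\<phi> x = x" "polarize \<phi> P f x = f x"
  | "\<phi> x \<noteq> x" "P x" "polarize \<phi> P f x = max (f x) (f (\<phi> x))"
    "polarize \<phi> P f (\<phi> x) = min (f x) (f (\<phi> x))"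
  | "\<phi> x \<noteq> x" "\<not> P x" "polarize \<phi> P f x = min (f x) (f (\<phi> x))"
    "polarize \<phi> P f (\<phi> x) = max (f x) (f (\<phi> x))"
  using halves[of x]
  by (cases "\<phi> x = x"; cases "P x") (auto simp: polarize_def max.commute min.commute)

text \<open>Polarization only permutes the values within each orbit. Squares as \<open>H\<close>
  give the norm, an indicator gives the size of the support.\<close>

lemma sum_polarize:
  "(\<Sum>x\<in>V. H (polarize \<phi> P f x)) = (\<Sum>x\<in>V. (H (f x) :: real))"
proof -
  have "H (polarize \<phi> P f x) + H (polarize \<phi> P f (\<phi> x)) = H (f x) + H (f (\<phi> x))" for x
    by (rule polarize_cases[of x f]) (auto simp: max_def min_def add.commute)
  then show ?thesis
    by (intro antisym sum_involution_mono[where \<phi> = \<phi>]) (auto intro: closed)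
qed

lemma polarize_add: "polarize \<phi> P f x + polarize \<phi> P f (\<phi> x) = f x + f (\<phi> x)"
  by (rule polarize_cases[of x f]) (auto simp: max_def min_def)

text \<open>The arc \<open>(x, y)\<close> is grouped with its image
  \<open>(\<phi> x, \<phi> y)\<close>. If both ends move and lie in equal halves, the rearrangement
  inequality applies; an arc from \<open>x\<close> to \<open>\<phi> x\<close> keeps its product. The
  second assumption excludes all other arcs between the halves.\<close>

lemma form_polarize_ge:
  assumes "\<And>x y. (x, y) \<in> E \<Longrightarrow> (\<phi> x, \<phi> y) \<in> E"
    and "\<And>x y. (x, y) \<in> E \<Longrightarrow> \<phi> x \<noteq> x \<Longrightarrow> \<phi> y \<noteq> y \<Longrightarrow> P x = P y \<or> y = \<phi> x"
  shows "(\<Sum>(x, y)\<in>E. f x * f y) \<le> (\<Sum>(x, y)\<in>E. polarize \<phi> P f x * polarize \<phi> P f y)"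
proof (rule sum_involution_mono[where \<phi> = "map_prod \<phi> \<phi>"], goal_cases)
  case (3 e)
  obtain x y where e: "e = (x, y)" by fastforce
  let ?p = "polarize \<phi> P f"
  have rearr: "a * c + b * d \<le> max a b * max c d + min a b * min c d" for a b c d :: real
  proof -
    consider "a \<le> b" "c \<le> d" | "b \<le> a" "d \<le> c" | "a \<le> b" "d \<le> c" | "b \<le> a" "c \<le> d"
      by linarith
    then show ?thesis
    proof cases
      case 3
      then have "(b - a) * (c - d) \<ge> 0" by simp
      then show ?thesis using 3 by (simp add: max_absorb2 min_absorb1 max_absorb1 min_absorb2 algebra_simps)
    next
      case 4
      then have "(a - b) * (d - c) \<ge> 0" by simp
      then show ?thesis using 4 by (simp add: max_absorb2 min_absorb1 max_absorb1 min_absorb2 algebra_simps)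
    qed (simp_all add: max_absorb2 min_absorb1 max_absorb1 min_absorb2)
  qed
  have "f x * f y + f (\<phi> x) * f (\<phi> y) \<le> ?p x * ?p y + ?p (\<phi> x) * ?p (\<phi> y)"
  proof (cases "y = \<phi> x")
    case True
    have "?p x * ?p (\<phi> x) = f x * f (\<phi> x)"
      by (rule polarize_cases[of x f]) (auto simp: max_def min_def)
    then show ?thesis using True by (simp add: mult.commute)
  next
    case False
    have "P x = P y" if "\<phi> x \<noteq> x" "\<phi> y \<noteq> y"
      using assms(2)[of x y] 3 e that False by auto
    then consider "\<phi> x = x" | "\<phi> y = y" | "\<phi> x \<noteq> x" "\<phi> y \<noteq> y" "P x" "P y"
      | "\<phi> x \<noteq> x" "\<phi> y \<noteq> y" "\<not> P x" "\<not> P y" by blast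
    then show ?thesis
    proof cases
      \<comment> \<open>A fixed end sees only the sum of the two values at the other end, which
        polarization preserves.\<close>
      case 1
      then have "?p x = f x" by (simp add: polarize_def)
      with 1 have "?p x * ?p y + ?p (\<phi> x) * ?p (\<phi> y) = f x * (?p y + ?p (\<phi> y))"
        by (simp add: distrib_left)
      then show ?thesis using 1 polarize_add[of f y] by (simp add: distrib_left)
    next
      case 2
      then have "?p y = f y" by (simp add: polarize_def)
      with 2 have "?p x * ?p y + ?p (\<phi> x) * ?p (\<phi> y) = f y * (?p x + ?p (\<phi> x))"
        by (simp add: distrib_left mult.commute)
      then show ?thesis using 2 polarize_add[of f x] by (simp add: distrib_left mult.commute)
    next
      case 3
      then show ?thesis
        using rearr[of "f x" "f y" "f (\<phi> x)" "f (\<phi> y)"] halves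
        by (simp add: polarize_def max.commute min.commute)
    next
      case 4
      then show ?thesis
        using rearr[of "f x" "f y" "f (\<phi> x)" "f (\<phi> y)"] halves
        by (simp add: polarize_def max.commute min.commute add.commute)
    qed
  qed
  then show ?case by (simp add: e)
qed (use assms(1) in \<open>auto simp: case_prod_unfold\<close>)

text \<open>Provides the decreasing measure for compression: the support moves to the half where
  \<open>W\<close> is smaller. The decrease is strict at \<open>z\<close>, which is missing from the
  support while its image is present. Nonnegativity makes the maximum nonzero as soon as one of the
  two values is.\<close>

lemma weight_polarize_less:
  fixes W :: "'a \<Rightarrow> nat" and f :: "'a \<Rightarrow> real"
  assumes nonneg: "\<And>x. f x \<ge> 0"
    and W: "\<And>x. x \<in> V \<Longrightarrow> P x \<Longrightarrow> \<phi> x \<noteq> x \<Longrightarrow> W x < W (\<phi> x)"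
    and z: "z \<in> V" "P z" "\<phi> z \<noteq> z" "f z = 0" "f (\<phi> z) \<noteq> 0"
  shows "sum W {x \<in> V. polarize \<phi> P f x \<noteq> 0} < sum W {x \<in> V. f x \<noteq> 0}"
proof -
  define w where "w g x = (if g x \<noteq> 0 then W x else 0)" for g :: "'a \<Rightarrow> real" and x
  let ?p = "polarize \<phi> P f"
  have w: "sum W {x \<in> V. g x \<noteq> 0} = sum (w g) V" for g :: "'a \<Rightarrow> real"
    unfolding w_def using finV by (simp add: sum.inter_filter)
  have pz: "?p z \<noteq> 0" "?p (\<phi> z) = 0"
    using z nonneg[of "\<phi> z"] halves[of z] by (auto simp: polarize_def max_def min_def)
  have le: "w ?p x + w ?p (\<phi> x) \<le> w f x + w f (\<phi> x)" if "x \<in> V" for x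
    using nonneg[of x] nonneg[of "\<phi> x"] W[OF that] W[OF closed[OF that]] halves[of x]
    by (rule_tac polarize_cases[of x f]) (auto simp: w_def max_def min_def)
  have less: "w ?p z + w ?p (\<phi> z) < w f z + w f (\<phi> z)"
    using pz z W[of z] by (simp add: w_def)
  have "2 * sum (w ?p) V = (\<Sum>x\<in>V. w ?p x + w ?p (\<phi> x))"
    by (simp only: sum.distrib sum_involution[where V = V and \<phi> = \<phi> and h = "w ?p", OF closed invol] mult_2)
  also have "\<dots> < (\<Sum>x\<in>V. w f x + w f (\<phi> x))"
    using finV le less z(1) by (intro sum_strict_mono_ex1) auto
  also have "\<dots> = 2 * sum (w f) V"
    by (simp only: sum.distrib sum_involution[where V = V and \<phi> = \<phi> and h = "w f", OF closed invol] mult_2)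
  finally show ?thesis by (simp add: w)
qed

end

section \<open>Compression to left-compressed down-sets\<close>

definition left_compressed :: "nat set set \<Rightarrow> bool" where
  "left_compressed A \<longleftrightarrow>
    (\<forall>x\<in>A. \<forall>b\<in>x. \<forall>a\<ge>1. a < b \<longrightarrow> a \<notin> x \<longrightarrow> insert a (x - {b}) \<in> A)"

definition down_closed :: "'a set set \<Rightarrow> bool" where
  "down_closed A \<longleftrightarrow> (\<forall>x\<in>A. \<forall>y\<subseteq>x. y \<in> A)"

text \<open>Preferring sets without \<open>a\<close> drives the support towards a down-set.\<close>

lemma polarization_flip:
  assumes "a \<in> {1..d}"
  shows "polarization (flip a) (\<lambda>x. a \<notin> x) (Pow {1..d::nat})"
  using assms by unfold_locales (auto simp: flip_subset in_flip_iff)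

lemma transpose_image_id:
  "Transposition.transpose a b ` x = x" if "a \<in> x \<longleftrightarrow> b \<in> x"
  using that by (simp add: transpose_image_eq)

text \<open>A set moved by the transposition contains exactly one of \<open>a\<close> and
  \<open>b\<close>, and its image contains the other one. For \<open>a < b\<close>, preferring
  \<open>a\<close> drives the support to the left.\<close>

lemma polarization_transpose:
  assumes "a \<in> {1..d}" "b \<in> {1..d}"
  shows "polarization (\<lambda>x. Transposition.transpose a b ` x) (\<lambda>x. a \<in> x) (Pow {1..d::nat})"
proof
  fix x
  show "Transposition.transpose a b ` Transposition.transpose a b ` x = x"
    by (simp add: image_image)
  show "Transposition.transpose a b ` x \<in> Pow {1..d}" if "x \<in> Pow {1..d}"
    using that assms by (auto simp: Transposition.transpose_def)
  show "(a \<in> Transposition.transpose a b ` x) = (a \<notin> x)"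
    if "Transposition.transpose a b ` x \<noteq> x"
  proof -
    have "(a \<in> x) \<noteq> (b \<in> x)" using that transpose_image_id[of a x b] by blast
    then show ?thesis by (force simp: Transposition.transpose_def image_iff)
  qed
qed auto

lemma transpose_image_swap:
  "a \<in> x \<Longrightarrow> b \<notin> x \<Longrightarrow> Transposition.transpose a b ` x = insert b (x - {a})"
  by (force simp: Transposition.transpose_def image_iff)

lemma sum_insert_diff_less:
  assumes "finite x" "a \<in> x" "b \<notin> x" "a < (b::nat)"
  shows "\<Sum>x < \<Sum>(insert b (x - {a}))"
proof -
  have "\<Sum>x = a + \<Sum>(x - {a})" using assms by (simp add: sum.remove)
  moreover have "\<Sum>(insert b (x - {a})) = b + \<Sum>(x - {a})" using assms by simp
  ultimately show ?thesis using assms by simp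
qed

text \<open>Permuting coordinates is an automorphism of the cube. If two moved sets differed at
  \<open>a\<close>, they would differ at \<open>b\<close> as well, but adjacent sets differ at one
  coordinate only.\<close>

lemma parcs_hypercube_transpose:
  assumes ab: "a \<in> {1..d}" "b \<in> {1..d}" and xy: "(x, y) \<in> parcs (hypercube d)"
  defines "\<tau> \<equiv> Transposition.transpose a b"
  shows "(\<tau> ` x, \<tau> ` y) \<in> parcs (hypercube d)"
    and "\<tau> ` x \<noteq> x \<Longrightarrow> \<tau> ` y \<noteq> y \<Longrightarrow> a \<in> x \<longleftrightarrow> a \<in> y"
proof -
  obtain c where c: "x \<subseteq> {1..d}" "c \<in> {1..d}" "y = flip c x"
    using xy by (auto simp: parcs_hypercube)
  have "\<tau> z \<in> {1..d}" if "z \<in> {1..d}" for z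
    using that ab by (auto simp: \<tau>_def Transposition.transpose_def)
  moreover have "\<tau> ` y = flip (\<tau> c) (\<tau> ` x)"
    unfolding c \<tau>_def by (rule image_flip) simp
  ultimately show "(\<tau> ` x, \<tau> ` y) \<in> parcs (hypercube d)"
    using c unfolding parcs_hypercube by blast
  assume "\<tau> ` x \<noteq> x" "\<tau> ` y \<noteq> y"
  then have "(a \<in> x) \<noteq> (b \<in> x)" "(a \<in> y) \<noteq> (b \<in> y)"
    using transpose_image_id unfolding \<tau>_def by metis+
  then show "a \<in> x \<longleftrightarrow> a \<in> y"
    using c(3) by (auto simp: in_flip_iff split: if_splits)
qed

text \<open>Flips commute, and only an edge in direction \<open>a\<close> changes membership of
  \<open>a\<close>.\<close>

lemma parcs_hypercube_flip:
  assumes a: "a \<in> {1..d}" and xy: "(x, y) \<in> parcs (hypercube d)"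
  shows "(flip a x, flip a y) \<in> parcs (hypercube d)"
    and "(a \<notin> x) = (a \<notin> y) \<or> y = flip a x"
proof -
  obtain c where c: "x \<subseteq> {1..d}" "c \<in> {1..d}" "y = flip c x"
    using xy by (auto simp: parcs_hypercube)
  have "flip a y = flip c (flip a x)" unfolding c by (rule flip_commute)
  moreover have "flip a x \<subseteq> {1..d}" using flip_subset[OF a] c(1) by blast
  ultimately show "(flip a x, flip a y) \<in> parcs (hypercube d)"
    unfolding parcs_hypercube using c(2) by blast
  show "(a \<notin> x) = (a \<notin> y) \<or> y = flip a x"
    using c by (auto simp: in_flip_iff)
qed

lemma down_closedI:
  assumes fin: "\<And>x. x \<in> A \<Longrightarrow> finite x"
    and step: "\<And>x a. x \<in> A \<Longrightarrow> a \<in> x \<Longrightarrow> x - {a} \<in> A"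
  shows "down_closed A"
proof -
  have *: "x - z \<in> A" if "finite z" "z \<subseteq> x" "x \<in> A" for x z
    using that
  proof (induction z rule: finite_induct)
    case (insert a z)
    have "x - z \<in> A" by (rule insert.IH) (use insert.prems in auto)
    moreover have "a \<in> x - z" using insert.prems(1) insert.hyps(2) by blast
    ultimately have "x - z - {a} \<in> A" by (rule step)
    then show ?case by (metis Diff_insert)
  qed simp
  have "y \<in> A" if "x \<in> A" "y \<subseteq> x" for x y
    using *[of "x - y" x] fin[OF that(1)] that by (simp add: double_diff)
  then show ?thesis unfolding down_closed_def by blast
qed

text \<open>Among all functions that are at least as good as \<open>f\<close>, one whose support has
  least total element sum admits no strictly improving polarization. Flips then give down-closure
  and transpositions left-compression.\<close>

lemma compressed_exists:
  fixes f :: "nat set \<Rightarrow> real"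
  assumes nonneg: "\<And>x. f x \<ge> 0"
  obtains g :: "nat set \<Rightarrow> real" where "\<And>x. g x \<ge> 0"
    and "card {x \<in> Pow {1..d}. g x \<noteq> 0} = card {x \<in> Pow {1..d}. f x \<noteq> 0}"
    and "(\<Sum>x\<in>Pow {1..d}. (g x)\<^sup>2) = (\<Sum>x\<in>Pow {1..d}. (f x)\<^sup>2)"
    and "(\<Sum>(x, y)\<in>parcs (hypercube d). f x * f y) \<le> (\<Sum>(x, y)\<in>parcs (hypercube d). g x * g y)"
    and "down_closed {x \<in> Pow {1..d}. g x \<noteq> 0}"
    and "left_compressed {x \<in> Pow {1..d}. g x \<noteq> 0}"
proof -
  define V :: "nat set set" where "V = Pow {1..d}"
  define A :: "(nat set \<Rightarrow> real) \<Rightarrow> nat set set" where "A g = {x \<in> V. g x \<noteq> 0}" for g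
  define Q :: "(nat set \<Rightarrow> real) \<Rightarrow> real"
    where "Q g = (\<Sum>(x, y)\<in>parcs (hypercube d). g x * g y)" for g
  define good where "good g \<longleftrightarrow> (\<forall>x. g x \<ge> 0) \<and> card (A g) = card (A f) \<and>
      (\<Sum>x\<in>V. (g x)\<^sup>2) = (\<Sum>x\<in>V. (f x)\<^sup>2) \<and> Q f \<le> Q g" for g
  have "good f" using nonneg by (simp add: good_def)
  then obtain g where g: "good g" and least: "\<And>h. good h \<Longrightarrow> sum Sum (A g) \<le> sum Sum (A h)"
    using ex_has_least_nat[of good f "\<lambda>g. sum Sum (A g)"] by blast
  \<comment> \<open>The contrapositive use of minimality: if only the image of \<open>z\<close> were
    in the support, polarizing would give a good function of smaller weight.\<close>
  have step: "z \<in> A g"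
    if pol: "polarization \<phi> P V"
      and E1: "\<And>x y. (x, y) \<in> parcs (hypercube d) \<Longrightarrow> (\<phi> x, \<phi> y) \<in> parcs (hypercube d)"
      and E2: "\<And>x y. (x, y) \<in> parcs (hypercube d) \<Longrightarrow> \<phi> x \<noteq> x \<Longrightarrow> \<phi> y \<noteq> y \<Longrightarrow> P x = P y \<or> y = \<phi> x"
      and W: "\<And>x. x \<in> V \<Longrightarrow> P x \<Longrightarrow> \<phi> x \<noteq> x \<Longrightarrow> \<Sum>x < \<Sum>(\<phi> x)"
      and z: "P z" "\<phi> z \<noteq> z" "\<phi> z \<in> A g"
    for \<phi> P z
  proof (rule ccontr)
    assume nz: "z \<notin> A g"
    interpret polarization \<phi> P V by (rule pol)
    let ?h = "polarize \<phi> P g"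
    have zV: "z \<in> V" using z(3) closed[of "\<phi> z"] by (simp add: A_def)
    have g0: "g x \<ge> 0" for x using g by (simp add: good_def)
    \<comment> \<open>The size of the support is written as a sum over values so that
      \<open>sum_polarize\<close> applies to it.\<close>
    have "card (A h) = (\<Sum>x\<in>V. if h x = 0 then 0 else 1 :: real)" for h
      using finV unfolding A_def by (simp add: sum.If_cases Collect_neg_eq Int_def)
    then have "real (card (A ?h)) = card (A g)"
      using sum_polarize[of "\<lambda>t. if t = 0 then 0 else 1" g] by simp
    moreover have "(\<Sum>x\<in>V. (?h x)\<^sup>2) = (\<Sum>x\<in>V. (g x)\<^sup>2)" by (rule sum_polarize)
    moreover have "Q g \<le> Q ?h" unfolding Q_def by (rule form_polarize_ge[OF E1 E2])
    moreover have "?h x \<ge> 0" for x using g0 by (simp add: polarize_def le_max_iff_disj)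
    ultimately have "good ?h" using g by (auto simp: good_def)
    moreover have "sum Sum (A ?h) < sum Sum (A g)"
      unfolding A_def
      by (rule weight_polarize_less[where f = g and W = Sum and z = z, OF g0 W _ _ _ _ _]) (use nz z zV in \<open>simp_all add: A_def\<close>)
    ultimately show False using least by fastforce
  qed
  have fin: "finite x" if "x \<in> V" for x using that by (auto simp: V_def intro: finite_subset)
  have "down_closed (A g)"
  proof (rule down_closedI)
    fix x a assume x: "x \<in> A g" "a \<in> x"
    then have xd: "x \<subseteq> {1..d}" and a: "a \<in> {1..d}" by (auto simp: A_def V_def)
    show "x - {a} \<in> A g"
    proof (rule step[of "flip a" "\<lambda>x. a \<notin> x"])
      show "polarization (flip a) (\<lambda>x. a \<notin> x) V"
        unfolding V_def by (rule polarization_flip[OF a])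
      show "\<Sum>u < \<Sum>(flip a u)" if "u \<in> V" "a \<notin> u" for u
        using that a fin by (simp add: flip_def)
      show "flip a (x - {a}) \<in> A g" using x by (simp add: flip_def insert_absorb)
    qed (use parcs_hypercube_flip[OF a] in auto)
  qed (auto simp: A_def fin)
  moreover have "left_compressed (A g)"
    unfolding left_compressed_def
  proof (intro ballI allI impI)
    fix x a b assume x: "x \<in> A g" "b \<in> x" "1 \<le> a" "a < b" "a \<notin> x"
    then have xd: "x \<subseteq> {1..d}" by (auto simp: A_def V_def)
    then have ab: "a \<in> {1..d}" "b \<in> {1..d}" using x by (auto simp: subset_iff)
    let ?\<phi> = "\<lambda>x. Transposition.transpose a b ` x"
    have \<phi>x: "?\<phi> (insert a (x - {b})) = x"
      using x by (subst transpose_image_swap) auto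
    show "insert a (x - {b}) \<in> A g"
    proof (rule step[of ?\<phi> "\<lambda>x. a \<in> x"])
      show "polarization ?\<phi> (\<lambda>x. a \<in> x) V"
        unfolding V_def by (rule polarization_transpose[OF ab])
      show "\<Sum>u < \<Sum>(?\<phi> u)" if "u \<in> V" "a \<in> u" "?\<phi> u \<noteq> u" for u
      proof -
        have "b \<notin> u" using that transpose_image_id[of a u b] by blast
        then show ?thesis
          using sum_insert_diff_less[of u a b] that fin x by (simp add: transpose_image_swap)
      qed
      show "?\<phi> (insert a (x - {b})) \<noteq> insert a (x - {b})"
        unfolding \<phi>x using x by blast
      show "?\<phi> (insert a (x - {b})) \<in> A g" unfolding \<phi>x by (rule x(1))
    qed (use parcs_hypercube_transpose[OF ab] in auto)
  qed
  ultimately show ?thesis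
    using that[of g] g unfolding good_def A_def V_def Q_def by blast
qed

text \<open>Induction replaces the elements above \<open>h\<close> one at a time by those of the target set.\<close>

lemma left_compressed_shift:
  assumes "left_compressed A" and "finite T" and "T \<subseteq> {1..h}" "R \<subseteq> {1..h}" "R \<inter> T = {}"
    and "X \<inter> {1..h} = {}" "card X = card T" "finite X" "0 \<notin> X" "R \<union> X \<in> A"
  shows "R \<union> T \<in> A"
  using assms(2-)
proof (induction T arbitrary: R X rule: finite_induct)
  case empty
  then show ?case by simp
next
  case (insert a T)
  then obtain b where b: "b \<in> X" by fastforce
  have a: "a \<in> {1..h}" "a \<notin> R" "a \<notin> X" using insert.prems(1,3,4) by auto
  have "b \<notin> {1..h}" using b insert.prems(4) unfolding disjoint_iff by metis
  moreover have "b \<noteq> 0" using b insert.prems(7) by metis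
  ultimately have "h < b" by simp
  then have ab: "1 \<le> a" "a < b" "a \<notin> R \<union> X" "b \<notin> R"
    using a insert.prems(2) by (auto simp: subset_iff)
  have "insert a (R \<union> X - {b}) \<in> A"
    using assms(1)[unfolded left_compressed_def, rule_format, OF insert.prems(8), of b a] b ab
    by simp
  also have "insert a (R \<union> X - {b}) = insert a R \<union> (X - {b})" using ab by blast
  finally have "insert a R \<union> T \<in> A"
  proof (intro insert.IH[of "insert a R" "X - {b}"])
    show "card (X - {b}) = card T" using insert.prems(5) insert.hyps b by simp
    show "(X - {b}) \<inter> {1..h} = {}" using insert.prems(4) by (simp add: disjoint_iff)
    show "insert a R \<inter> T = {}" using insert.prems(3) insert.hyps by auto
  qed (use insert.prems in simp_all)
  then show ?case by simp
qed

text \<open>Otherwise down-closure leaves a member consisting of \<open>k\<close> elements above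
  \<open>h\<close>, and shifting it to the left yields every \<open>k\<close>-subset of
  \<open>{1..h}\<close>, more sets than \<open>A\<close> has.\<close>

lemma card_tail_less:
  assumes A: "A \<subseteq> Pow {1..d}" "down_closed A" "left_compressed A"
    and card: "card A < h choose k" and x: "x \<in> A"
  shows "card (x \<inter> {h<..d}) < k"
proof (rule ccontr)
  assume "\<not> ?thesis"
  then obtain X where X: "X \<subseteq> x \<inter> {h<..d}" "card X = k"
    by (meson not_less obtain_subset_with_card_n)
  have "X \<in> A" using A(2) x X by (auto simp: down_closed_def)
  have "finite X" using X finite_subset by blast
  have "{T. T \<subseteq> {1..h} \<and> card T = k} \<subseteq> A"
  proof safe
    fix T assume T: "T \<subseteq> {1..h}" "k = card T"
    have "{} \<union> T \<in> A"
      by (rule left_compressed_shift[OF A(3), of T h "{}" X])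
        (use T X \<open>X \<in> A\<close> \<open>finite X\<close> in \<open>auto intro: finite_subset\<close>)
    then show "T \<in> A" by simp
  qed
  moreover have "finite A" using A(1) by (rule finite_subset) simp
  ultimately have "card {T. T \<subseteq> {1..h} \<and> card T = k} \<le> card A" by (rule card_mono[rotated])
  then show False using card n_subsets[of "{1..h}" k] by simp
qed

section \<open>Edges in a set of directions\<close>

lemma finite_parcs_hypercube: "finite (parcs (hypercube d))"
  by (rule finite_subset[of _ "Pow {1..d} \<times> Pow {1..d}"]) (auto simp: hypercube_def)

text \<open>The share of the edges in directions \<open>X\<close>, which makes the quadratic form
  additive over a partition of the directions.\<close>

definition dir_form :: "nat \<Rightarrow> nat set \<Rightarrow> (nat set \<Rightarrow> real) \<Rightarrow> real" where
  "dir_form d X g = (\<Sum>x\<in>Pow {1..d}. \<Sum>a\<in>X. g x * g (flip a x))"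

lemma sum_parcs_eq_dir_form: "(\<Sum>(x, y)\<in>parcs (hypercube d). g x * g y) = dir_form d {1..d} g"
  by (simp add: sum_parcs_hypercube dir_form_def)

lemma dir_form_Un:
  assumes "finite X" "finite Y" "X \<inter> Y = {}"
  shows "dir_form d (X \<union> Y) g = dir_form d X g + dir_form d Y g"
  using assms by (simp add: dir_form_def sum.union_disjoint sum.distrib)

lemma sum_flip:
  assumes "a \<in> {1..d}"
  shows "(\<Sum>x\<in>Pow {1..d}. h (flip a x)) = (\<Sum>x\<in>Pow {1..d}. h x)"
  by (rule sum_involution) (use assms in \<open>auto simp only: Pow_iff flip_subset flip_flip\<close>)

text \<open>AM-GM on each edge with ratio \<open>w\<close>; the second half of the bound becomes the first one after
  flipping, because flipping inverts the ratio.\<close>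

lemma dir_form_le_weight:
  fixes c :: real and g :: "nat set \<Rightarrow> real"
  assumes X: "X \<subseteq> {1..d}" and c: "c > 0"
  shows "dir_form d X g
    \<le> (\<Sum>x\<in>Pow {1..d}. (c * card (x \<inter> X) + card (X - x) / c) * (g x)\<^sup>2)"
proof -
  have finX: "finite X" using X finite_subset by blast
  define w where "w x a = (if a \<in> x then c else 1 / c)" for x :: "nat set" and a
  have wpos: "w x a > 0" for x a using c by (simp add: w_def)
  have wflip: "w (flip a x) a = 1 / w x a" for x a by (simp add: w_def in_flip_iff)
  have amgm: "p * q \<le> (u * p\<^sup>2 + 1 / u * q\<^sup>2) / 2" if "u > 0" for p q u :: real
  proof -
    have "0 \<le> (u * p - q)\<^sup>2 / u" using that by simp
    also have "\<dots> = u * p\<^sup>2 + 1 / u * q\<^sup>2 - 2 * (p * q)"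
      using that by (simp add: field_simps power2_eq_square)
    finally show ?thesis by simp
  qed
  have "dir_form d X g
      \<le> (\<Sum>x\<in>Pow {1..d}. \<Sum>a\<in>X. (w x a * (g x)\<^sup>2 + w (flip a x) a * (g (flip a x))\<^sup>2) / 2)"
    unfolding dir_form_def wflip by (intro sum_mono amgm wpos)
  also have "\<dots> = (\<Sum>a\<in>X. \<Sum>x\<in>Pow {1..d}.
      (w x a * (g x)\<^sup>2 + w (flip a x) a * (g (flip a x))\<^sup>2) / 2)"
    by (rule sum.swap)
  also have "\<dots> = (\<Sum>a\<in>X. \<Sum>x\<in>Pow {1..d}. w x a * (g x)\<^sup>2)"
  proof (rule sum.cong[OF refl])
    fix a assume "a \<in> X"
    then have a: "a \<in> {1..d}" using X by blast
    show "(\<Sum>x\<in>Pow {1..d}. (w x a * (g x)\<^sup>2 + w (flip a x) a * (g (flip a x))\<^sup>2) / 2)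
        = (\<Sum>x\<in>Pow {1..d}. w x a * (g x)\<^sup>2)"
      using sum_flip[OF a, of "\<lambda>x. w x a * (g x)\<^sup>2"]
      by (simp only: sum_divide_distrib[symmetric] sum.distrib) simp
  qed
  also have "\<dots> = (\<Sum>x\<in>Pow {1..d}. \<Sum>a\<in>X. w x a * (g x)\<^sup>2)"
    by (rule sum.swap)
  also have "\<dots> = (\<Sum>x\<in>Pow {1..d}. (c * card (x \<inter> X) + card (X - x) / c) * (g x)\<^sup>2)"
  proof (rule sum.cong[OF refl])
    fix x
    have "(\<Sum>a\<in>X. w x a) = (\<Sum>a\<in>X \<inter> x. c) + (\<Sum>a\<in>X - x. 1 / c)"
      unfolding w_def using finX by (simp add: sum.If_cases Diff_eq Int_commute)
    then show "(\<Sum>a\<in>X. w x a * (g x)\<^sup>2) = (c * card (x \<inter> X) + card (X - x) / c) * (g x)\<^sup>2"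
      by (simp add: sum_distrib_right[symmetric] Int_commute mult.commute)
  qed
  finally show ?thesis .
qed

lemma dir_form_le_card:
  fixes g :: "nat set \<Rightarrow> real"
  assumes X: "X \<subseteq> {1..d}"
  shows "dir_form d X g \<le> real (card X) * (\<Sum>x\<in>Pow {1..d}. (g x)\<^sup>2)"
proof -
  have "finite X" using X finite_subset by blast
  then have "real (card (x \<inter> X)) + real (card (X - x)) = card X" for x
    by (simp add: Int_commute flip: of_nat_add card_Int_Diff)
  then show ?thesis
    using dir_form_le_weight[OF X, of 1 g] by (simp add: sum_distrib_left)
qed

lemma dir_form_le_sqrt:
  fixes g :: "nat set \<Rightarrow> real"
  assumes X: "X \<subseteq> {1..d}" and "j > 0"
    and supp: "\<And>x. x \<subseteq> {1..d} \<Longrightarrow> g x \<noteq> 0 \<Longrightarrow> card (x \<inter> X) \<le> j"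
  shows "dir_form d X g \<le> 2 * sqrt (real (j * card X)) * (\<Sum>x\<in>Pow {1..d}. (g x)\<^sup>2)"
proof (cases "X = {}")
  case True
  then show ?thesis by (simp add: dir_form_def)
next
  case False
  have finX: "finite X" using X finite_subset by blast
  \<comment> \<open>This ratio balances the two terms: \<open>c * j\<close> and
    \<open>card X / c\<close> both equal \<open>sqrt (j * card X)\<close>.\<close>
  define c where "c = sqrt (card X) / sqrt j"
  have pos: "sqrt (card X) > 0" "sqrt j > 0"
    using False finX \<open>j > 0\<close> by (auto simp: card_gt_0_iff)
  then have c: "c > 0" by (simp add: c_def)
  have c_eq: "c * j = sqrt (real (j * card X))" "card X / c = sqrt (real (j * card X))"
    unfolding c_def using pos
    by (simp_all add: real_sqrt_mult field_simps)
  have "dir_form d X g \<le> (\<Sum>x\<in>Pow {1..d}. (c * card (x \<inter> X) + card (X - x) / c) * (g x)\<^sup>2)"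
    by (rule dir_form_le_weight[OF X c])
  also have "\<dots> \<le> (\<Sum>x\<in>Pow {1..d}. (2 * sqrt (real (j * card X))) * (g x)\<^sup>2)"
  proof (rule sum_mono)
    fix x assume x: "x \<in> Pow {1..d}"
    show "(c * card (x \<inter> X) + card (X - x) / c) * (g x)\<^sup>2 \<le> (2 * sqrt (real (j * card X))) * (g x)\<^sup>2"
    proof (cases "g x = 0")
      case False
      then have "card (x \<inter> X) \<le> j" using supp x by blast
      then have "c * card (x \<inter> X) \<le> c * j" using c by simp
      moreover have "card (X - x) / c \<le> card X / c"
        using c finX by (simp add: divide_right_mono card_mono)
      ultimately show ?thesis unfolding c_eq by (intro mult_right_mono) auto
    qed simp
  qed
  also have "\<dots> = 2 * sqrt (real (j * card X)) * (\<Sum>x\<in>Pow {1..d}. (g x)\<^sup>2)"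
    by (simp add: sum_distrib_left)
  finally show ?thesis .
qed

text \<open>The ball is an induced subgraph, so its form agrees with that of the cube on functions
  supported in it.\<close>

lemma dir_form_le_lambda1_ball:
  fixes g :: "nat set \<Rightarrow> real"
  assumes supp: "\<And>x. x \<subseteq> {1..d} \<Longrightarrow> g x \<noteq> 0 \<Longrightarrow> card x \<le> j"
  shows "dir_form d {1..d} g \<le> lambda1 (hamming_ball d j) * (\<Sum>x\<in>Pow {1..d}. (g x)\<^sup>2)"
proof -
  have "{} \<in> pverts (hamming_ball d j)" by (simp add: hamming_ball_def small_subsets_def)
  then have ne: "pverts (hamming_ball d j) \<noteq> {}" by blast
  have "dir_form d {1..d} g = (\<Sum>(x, y)\<in>parcs (hamming_ball d j). g x * g y)"
    unfolding sum_parcs_eq_dir_form[symmetric]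
    using finite_parcs_hypercube supp
    by (intro sum.mono_neutral_right) (auto simp: hamming_ball_def hypercube_def small_subsets_def)
  also have "\<dots> \<le> lambda1 (hamming_ball d j) * (\<Sum>x\<in>pverts (hamming_ball d j). (g x)\<^sup>2)"
    using lambda1_rayleigh[OF pair_graph_hamming_ball ne] by blast
  also have "(\<Sum>x\<in>pverts (hamming_ball d j). (g x)\<^sup>2) = (\<Sum>x\<in>Pow {1..d}. (g x)\<^sup>2)"
    using supp by (intro sum.mono_neutral_left) (auto simp: hamming_ball_def small_subsets_def)
  finally show ?thesis .
qed

lemma sum_Pow_split:
  assumes "X \<subseteq> D"
  shows "(\<Sum>x\<in>Pow D. F x) = (\<Sum>r\<in>Pow (D - X). \<Sum>s\<in>Pow X. F (r \<union> s))"
  unfolding sum.cartesian_product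
  by (rule sum.reindex_bij_witness[where i = "\<lambda>(r, s). r \<union> s" and j = "\<lambda>x. (x - X, x \<inter> X)"])
    (use assms in \<open>auto simp: Un_Diff_Int Int_Un_distrib2 Un_commute\<close>)

text \<open>Edges in directions \<open>X\<close> keep the part \<open>r\<close> of a vertex outside
  \<open>X\<close>. Each slice with fixed \<open>r\<close>, extended by zero, is a function
  supported in the ball of radius \<open>j\<close>, and the slices add up.\<close>

lemma dir_form_le_lambda1_slice:
  fixes g :: "nat set \<Rightarrow> real"
  assumes X: "X \<subseteq> {1..d}"
    and supp: "\<And>x. x \<subseteq> {1..d} \<Longrightarrow> g x \<noteq> 0 \<Longrightarrow> card (x \<inter> X) \<le> j"
  shows "dir_form d X g \<le> lambda1 (hamming_ball d j) * (\<Sum>x\<in>Pow {1..d}. (g x)\<^sup>2)"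
proof -
  let ?l = "lambda1 (hamming_ball d j)"
  have slice: "(\<Sum>s\<in>Pow X. \<Sum>a\<in>X. g (r \<union> s) * g (flip a (r \<union> s)))
      \<le> ?l * (\<Sum>s\<in>Pow X. (g (r \<union> s))\<^sup>2)" if r: "r \<in> Pow ({1..d} - X)" for r
  proof -
    define h where "h s = (if s \<subseteq> X then g (r \<union> s) else 0)" for s
    have "flip a (r \<union> s) = r \<union> flip a s" if "a \<in> X" for a s
      using r that by (auto simp: flip_def)
    then have "(\<Sum>s\<in>Pow X. \<Sum>a\<in>X. g (r \<union> s) * g (flip a (r \<union> s)))
        = (\<Sum>s\<in>Pow X. \<Sum>a\<in>X. h s * h (flip a s))"
      by (intro sum.cong) (auto simp: h_def flip_subset)
    also have "\<dots> = (\<Sum>s\<in>Pow X. \<Sum>a\<in>{1..d}. h s * h (flip a s))"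
      using X by (intro sum.cong sum.mono_neutral_left) (auto simp: h_def flip_def)
    also have "\<dots> = dir_form d {1..d} h"
      unfolding dir_form_def using X by (intro sum.mono_neutral_left) (auto simp: h_def)
    also have "\<dots> \<le> ?l * (\<Sum>s\<in>Pow {1..d}. (h s)\<^sup>2)"
    proof (rule dir_form_le_lambda1_ball)
      fix s assume "s \<subseteq> {1..d}" "h s \<noteq> 0"
      then have "s \<subseteq> X" "g (r \<union> s) \<noteq> 0" by (auto simp: h_def split: if_splits)
      moreover from this have "(r \<union> s) \<inter> X = s" using r by auto
      moreover have "r \<union> s \<subseteq> {1..d}" using r \<open>s \<subseteq> {1..d}\<close> by auto
      ultimately show "card s \<le> j" using supp by metis
    qed
    also have "(\<Sum>s\<in>Pow {1..d}. (h s)\<^sup>2) = (\<Sum>s\<in>Pow X. (g (r \<union> s))\<^sup>2)"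
      using X by (intro sum.mono_neutral_cong_right) (auto simp: h_def)
    finally show ?thesis .
  qed
  have "dir_form d X g
      = (\<Sum>r\<in>Pow ({1..d} - X). \<Sum>s\<in>Pow X. \<Sum>a\<in>X. g (r \<union> s) * g (flip a (r \<union> s)))"
    unfolding dir_form_def by (rule sum_Pow_split[OF X])
  also have "\<dots> \<le> (\<Sum>r\<in>Pow ({1..d} - X). ?l * (\<Sum>s\<in>Pow X. (g (r \<union> s))\<^sup>2))"
    by (rule sum_mono) (rule slice)
  also have "\<dots> = ?l * (\<Sum>x\<in>Pow {1..d}. (g x)\<^sup>2)"
    unfolding sum_Pow_split[OF X] by (simp add: sum_distrib_left)
  finally show ?thesis .
qed

section \<open>The Hamming ball\<close>

lemma sum_Pow_card:
  fixes F :: "nat \<Rightarrow> real"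
  shows "(\<Sum>x\<in>Pow {1..d}. F (card x)) = (\<Sum>k\<le>d. (d choose k) * F k)"
proof -
  have "card x \<le> d" if "x \<in> Pow {1..d}" for x
    using card_mono[of "{1..d}" x] that by simp
  then have "card ` Pow {1..d} \<subseteq> {..d}" by blast
  then have "(\<Sum>x\<in>Pow {1..d}. F (card x))
      = (\<Sum>k\<le>d. \<Sum>x\<in>{x \<in> Pow {1..d}. card x = k}. F (card x))"
    by (intro sum.group[symmetric]) simp_all
  also have "\<dots> = (\<Sum>k\<le>d. (d choose k) * F k)"
  proof (rule sum.cong[OF refl])
    fix k
    have "card {x \<in> Pow {1..d}. card x = k} = d choose k"
      using n_subsets[of "{1..d}" k] by simp
    then show "(\<Sum>x\<in>{x \<in> Pow {1..d}. card x = k}. F (card x)) = (d choose k) * F k" by simp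
  qed
  finally show ?thesis .
qed

text \<open>A \<open>k\<close>-set has \<open>k\<close> neighbours below and \<open>d - k\<close>
  above. The factors \<open>k\<close> and \<open>d - k\<close> cancel the meaningless terms at
  \<open>k = 0\<close> and \<open>k = d\<close>.\<close>

lemma dir_form_radial:
  fixes F :: "nat \<Rightarrow> real"
  shows "dir_form d {1..d} (\<lambda>x. F (card x))
    = (\<Sum>k\<le>d. (d choose k) * (F k * (k * F (k - 1) + real (d - k) * F (Suc k))))"
proof -
  have "(\<Sum>a\<in>{1..d}. F (card x) * F (card (flip a x)))
      = F (card x) * (card x * F (card x - 1) + real (d - card x) * F (Suc (card x)))"
    if "x \<in> Pow {1..d}" for x
  proof -
    have x: "x \<subseteq> {1..d}" "finite x" using that by (auto intro: finite_subset)
    have "(\<Sum>a\<in>{1..d}. F (card (flip a x)))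
        = (\<Sum>a\<in>x. F (card (flip a x))) + (\<Sum>a\<in>{1..d} - x. F (card (flip a x)))"
      using sum.subset_diff[OF x(1), of "\<lambda>a. F (card (flip a x))"] by simp
    also have "(\<Sum>a\<in>x. F (card (flip a x))) = (\<Sum>a\<in>x. F (card x - 1))"
      using x by (intro sum.cong) (auto simp: flip_def)
    also have "(\<Sum>a\<in>{1..d} - x. F (card (flip a x))) = (\<Sum>a\<in>{1..d} - x. F (Suc (card x)))"
      using x by (intro sum.cong) (auto simp: flip_def)
    finally show ?thesis
      using x by (simp add: sum_distrib_left[symmetric] card_Diff_subset)
  qed
  then have "dir_form d {1..d} (\<lambda>x. F (card x)) = (\<Sum>x\<in>Pow {1..d}.
      F (card x) * (card x * F (card x - 1) + real (d - card x) * F (Suc (card x))))"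
    unfolding dir_form_def by (rule sum.cong[OF refl])
  also have "\<dots> = (\<Sum>k\<le>d. (d choose k) * (F k * (k * F (k - 1) + real (d - k) * F (Suc k))))"
    by (rule sum_Pow_card[of "\<lambda>k. F k * (k * F (k - 1) + real (d - k) * F (Suc k))"])
  finally show ?thesis .
qed

text \<open>The number of edges between layers \<open>k\<close> and \<open>k + 1\<close>, over the
  geometric mean of the layer sizes: the contribution of these edges when each layer carries mass
  one.\<close>

lemma layer_weight:
  assumes "k < d"
  shows "real (d choose Suc k) * real (Suc k) / (sqrt (d choose Suc k) * sqrt (d choose k))
      = sqrt (real (Suc k * (d - k)))"
proof -
  define p q where "p = real (d choose Suc k)" and "q = real (d choose k)"
  have pos: "p > 0" "q > 0" using assms by (simp_all add: p_def q_def)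
  have "Suc k * (d choose Suc k) = (d - k) * (d choose k)"
    using binomial_absorb_comp[of d k] binomial_absorption[of k d] assms by simp
  then have "real (Suc k * (d choose Suc k)) = real ((d - k) * (d choose k))" by (rule arg_cong)
  then have pq: "real (Suc k) * p = real (d - k) * q" by (simp only: of_nat_mult p_def q_def)
  have "(p * Suc k / (sqrt p * sqrt q))\<^sup>2 = p\<^sup>2 * (real (Suc k))\<^sup>2 / (p * q)"
    using pos by (simp only: power_divide power_mult_distrib) simp
  also have "\<dots> = real (Suc k) * (Suc k * p) / q"
    using pos by (simp add: power2_eq_square)
  also have "\<dots> = real (Suc k * (d - k))" unfolding pq using pos by (simp only: of_nat_mult) simp
  finally show ?thesis
    unfolding p_def[symmetric] q_def[symmetric] using pos
    by (intro real_sqrt_unique[symmetric]) auto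
qed

text \<open>The test function has mass one on each of the layers \<open>l\<close> to
  \<open>i\<close>, so its norm is \<open>i - l + 1\<close>. Each of the \<open>i - l\<close> pairs
  of consecutive layers contributes its weight twice, and the square root bounds all these weights
  from below.\<close>

lemma lambda1_ball_ge:
  assumes "l \<le> i" "i \<le> d"
  shows "2 * real (i - l) * sqrt (real (Suc l * (d - i + 1))) \<le> lambda1 (hamming_ball d i) * real (i - l + 1)"
proof -
  define F :: "nat \<Rightarrow> real" where "F k = (if l \<le> k \<and> k \<le> i then 1 / sqrt (d choose k) else 0)" for k
  define m where "m = sqrt (real (Suc l * (d - i + 1)))"
  have mono: "m \<le> sqrt (real (Suc k * (d - k)))" if "l \<le> k" "k < i" for k
    unfolding m_def real_sqrt_le_iff of_nat_le_iff by (intro mult_le_mono) (use that assms in auto)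
  have "(\<Sum>x\<in>Pow {1..d}. (F (card x))\<^sup>2) = (\<Sum>k\<le>d. (d choose k) * (F k)\<^sup>2)"
    by (rule sum_Pow_card[of "\<lambda>k. (F k)\<^sup>2"])
  also have "\<dots> = (\<Sum>k\<in>{l..i}. 1)"
    using assms by (intro sum.mono_neutral_cong_right) (auto simp: F_def power_divide)
  finally have N: "(\<Sum>x\<in>Pow {1..d}. (F (card x))\<^sup>2) = real (i - l + 1)" using assms by simp
  \<comment> \<open>The two terms at \<open>k\<close> stand for the edges down to layer
    \<open>k - 1\<close> and up to layer \<open>k + 1\<close>, present only inside the range of the
    test function.\<close>
  have "(\<Sum>k\<in>{l..i}. (if l < k then m else 0) + (if k < i then m else 0))
      \<le> (\<Sum>k\<in>{l..i}. (d choose k) * (F k * (k * F (k - 1) + real (d - k) * F (Suc k))))"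
  proof (rule sum_mono)
    fix k assume k: "k \<in> {l..i}"
    have "(if l < k then m else 0) \<le> (d choose k) * (F k * (k * F (k - 1)))"
    proof (cases "l < k")
      case True
      then obtain k' where k': "k = Suc k'" by (cases k) auto
      have "m \<le> sqrt (real (Suc k' * (d - k')))" using mono[of k'] k k' True by simp
      also have "\<dots> = real (d choose k) * real (Suc k') / (sqrt (d choose k) * sqrt (d choose k'))"
        unfolding k' by (rule layer_weight[symmetric]) (use k k' assms in simp)
      also have "\<dots> = (d choose k) * (F k * (k * F (k - 1)))"
        using k True by (simp add: F_def k')
      finally show ?thesis using True by simp
    qed (simp add: F_def)
    moreover have "(if k < i then m else 0) \<le> (d choose k) * (F k * (real (d - k) * F (Suc k)))"
    proof (cases "k < i")
      case True
      then have "k < d" using assms by simp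
      have "m \<le> sqrt (real (Suc k * (d - k)))" using mono[of k] k True by simp
      also have "\<dots> = real (d choose Suc k) * real (Suc k) / (sqrt (d choose Suc k) * sqrt (d choose k))"
        by (rule layer_weight[symmetric]) fact
      also have "real (d choose Suc k) * real (Suc k) = real (d choose k) * real (d - k)"
        using binomial_absorb_comp[of d k] binomial_absorption[of k d] \<open>k < d\<close>
        by (metis mult.commute of_nat_mult)
      also have "real (d choose k) * real (d - k) / (sqrt (d choose Suc k) * sqrt (d choose k))
          = (d choose k) * (F k * (real (d - k) * F (Suc k)))"
        using k True by (simp add: F_def)
      finally show ?thesis using True by simp
    qed (simp add: F_def)
    ultimately show "(if l < k then m else 0) + (if k < i then m else 0)
        \<le> (d choose k) * (F k * (k * F (k - 1) + real (d - k) * F (Suc k)))"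
      by (simp add: distrib_left)
  qed
  also have "\<dots> = (\<Sum>k\<le>d. (d choose k) * (F k * (k * F (k - 1) + real (d - k) * F (Suc k))))"
    using assms by (intro sum.mono_neutral_left) (auto simp: F_def)
  also have "\<dots> = dir_form d {1..d} (\<lambda>x. F (card x))" by (rule dir_form_radial[symmetric])
  also have "\<dots> \<le> lambda1 (hamming_ball d i) * (\<Sum>x\<in>Pow {1..d}. (F (card x))\<^sup>2)"
    by (rule dir_form_le_lambda1_ball) (auto simp: F_def split: if_splits)
  also have "\<dots> = lambda1 (hamming_ball d i) * real (i - l + 1)" unfolding N ..
  finally have "(\<Sum>k\<in>{l..i}. (if l < k then m else 0) + (if k < i then m else 0))
      \<le> lambda1 (hamming_ball d i) * real (i - l + 1)" .
  moreover have "(\<Sum>k\<in>{l..i}. if l < k then m else 0) = real (i - l) * m"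
  proof -
    have "(\<Sum>k\<in>{l..i}. if l < k then m else 0) = (\<Sum>k\<in>{l<..i}. m)"
      by (intro sum.mono_neutral_cong_right) auto
    then show ?thesis by simp
  qed
  moreover have "(\<Sum>k\<in>{l..i}. if k < i then m else 0) = real (i - l) * m"
  proof -
    have "(\<Sum>k\<in>{l..i}. if k < i then m else 0) = (\<Sum>k\<in>{l..<i}. m)"
      by (intro sum.mono_neutral_cong_right) auto
    then show ?thesis by simp
  qed
  ultimately show ?thesis unfolding m_def by (simp add: sum.distrib)
qed

section \<open>Splitting the directions\<close>

lemma sum_abs_extend:
  assumes "V \<subseteq> U" "finite U"
  shows "(\<Sum>x\<in>U. (if x \<in> V then \<bar>f x\<bar> else 0)\<^sup>2) = (\<Sum>x\<in>V. (f x :: real)\<^sup>2)"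
  using assms by (intro sum.mono_neutral_cong_right) auto

text \<open>Reduction to compressed supports: an extremal eigenvector of \<open>G\<close> is
  replaced by its absolute value, extended by zero to the cube and then compressed. No step
  decreases the form, and the norm is kept.\<close>

lemma lambda1_le_dir_form:
  assumes graph: "pair_graph G" and sub: "subgraph (with_proj G) (with_proj (hypercube d))"
    and ne: "pverts G \<noteq> {}"
    and bound: "\<And>g. \<lbrakk>\<And>x. g x \<ge> 0; card {x \<in> Pow {1..d}. g x \<noteq> 0} \<le> card (pverts G);
        down_closed {x \<in> Pow {1..d}. g x \<noteq> 0}; left_compressed {x \<in> Pow {1..d}. g x \<noteq> 0}\<rbrakk>
      \<Longrightarrow> dir_form d {1..d} g \<le> B * (\<Sum>x\<in>Pow {1..d}. (g x)\<^sup>2)"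
  shows "lambda1 G \<le> B"
proof -
  interpret pair_graph G by fact
  have VP: "pverts G \<subseteq> Pow {1..d}" and EP: "parcs G \<subseteq> parcs (hypercube d)"
    using sub by (auto simp: subgraph_def hypercube_def)
  obtain f where f_nz: "\<exists>u\<in>pverts G. f u \<noteq> 0"
    and f: "(\<Sum>(u, w)\<in>parcs G. f u * f w) = lambda1 G * (\<Sum>u\<in>pverts G. (f u)\<^sup>2)"
    and "\<And>g. (\<Sum>(u, w)\<in>parcs G. g u * g w) \<le> lambda1 G * (\<Sum>u\<in>pverts G. (g u)\<^sup>2)"
    by (rule lambda1_rayleigh[OF graph ne], rule that; assumption)
  obtain u where u: "u \<in> pverts G" "f u \<noteq> 0" using f_nz by blast
  define f' where "f' x = (if x \<in> pverts G then \<bar>f x\<bar> else 0)" for x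
  have f'0: "f' x \<ge> 0" for x by (simp add: f'_def)
  obtain g where g0: "\<And>x. g x \<ge> 0"
    and card: "card {x \<in> Pow {1..d}. g x \<noteq> 0} = card {x \<in> Pow {1..d}. f' x \<noteq> 0}"
    and norm: "(\<Sum>x\<in>Pow {1..d}. (g x)\<^sup>2) = (\<Sum>x\<in>Pow {1..d}. (f' x)\<^sup>2)"
    and form: "(\<Sum>(x, y)\<in>parcs (hypercube d). f' x * f' y)
      \<le> (\<Sum>(x, y)\<in>parcs (hypercube d). g x * g y)"
    and compr: "down_closed {x \<in> Pow {1..d}. g x \<noteq> 0}" "left_compressed {x \<in> Pow {1..d}. g x \<noteq> 0}"
    by (rule compressed_exists[where f = f' and d = d, OF f'0], rule that; assumption)
  have N: "(\<Sum>x\<in>Pow {1..d}. (f' x)\<^sup>2) = (\<Sum>u\<in>pverts G. (f u)\<^sup>2)"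
    unfolding f'_def using VP by (rule sum_abs_extend) simp
  have "lambda1 G * (\<Sum>u\<in>pverts G. (f u)\<^sup>2) \<le> (\<Sum>(u, w)\<in>parcs G. f' u * f' w)"
    unfolding f[symmetric]
  proof (rule sum_mono, clarify)
    fix x y assume "(x, y) \<in> parcs G"
    then have "x \<in> pverts G" "y \<in> pverts G" using in_arcsD1 in_arcsD2 by auto
    then show "f x * f y \<le> f' x * f' y"
      by (simp add: f'_def flip: abs_mult)
  qed
  also have "\<dots> \<le> (\<Sum>(u, w)\<in>parcs (hypercube d). f' u * f' w)"
    using EP f'0 by (intro sum_mono2) (auto simp: finite_parcs_hypercube)
  also note form
  also have "(\<Sum>(x, y)\<in>parcs (hypercube d). g x * g y) \<le> B * (\<Sum>u\<in>pverts G. (f u)\<^sup>2)"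
    unfolding sum_parcs_eq_dir_form N[symmetric] norm[symmetric]
  proof (rule bound[OF g0 _ compr])
    show "card {x \<in> Pow {1..d}. g x \<noteq> 0} \<le> card (pverts G)"
      unfolding card by (rule card_mono) (auto simp: f'_def split: if_splits)
  qed
  finally have "lambda1 G * (\<Sum>u\<in>pverts G. (f u)\<^sup>2) \<le> B * (\<Sum>u\<in>pverts G. (f u)\<^sup>2)" .
  moreover have "(\<Sum>u\<in>pverts G. (f u)\<^sup>2) > 0"
    using u by (intro sum_pos2[of _ u]) auto
  ultimately show ?thesis by simp
qed

text \<open>Directions up to \<open>h1\<close> are bounded by their number, those up to
  \<open>h2\<close> by AM-GM and the rest by AM-GM or by slicing. The conditions
  \<open>cards\<close> bound the trace of a member of the support on the last two parts by
  \<open>k\<close> and \<open>j\<close>.\<close>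

lemma lambda1_le_three_parts:
  assumes graph: "pair_graph G" and sub: "subgraph (with_proj G) (with_proj (hypercube d))"
    and ne: "pverts G \<noteq> {}"
    and h: "h1 \<le> h2" "h2 \<le> d" and pos: "k > 0" "j > 0"
    and cards: "card (pverts G) < h1 choose Suc k" "card (pverts G) < h2 choose Suc j"
  shows "lambda1 G \<le> real h1 + 2 * sqrt (real (k * h2)) + min (2 * sqrt (real (j * d))) (lambda1 (hamming_ball d j))"
proof (rule lambda1_le_dir_form[OF graph sub ne])
  fix g :: "nat set \<Rightarrow> real"
  let ?A = "{x \<in> Pow {1..d}. g x \<noteq> 0}"
  let ?N = "\<Sum>x\<in>Pow {1..d}. (g x)\<^sup>2"
  assume card: "card ?A \<le> card (pverts G)" and compr: "down_closed ?A" "left_compressed ?A"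
  have AP: "?A \<subseteq> Pow {1..d}" by blast
  have N0: "?N \<ge> 0" by (simp add: sum_nonneg)
  have mid: "card (x \<inter> {h1<..h2}) \<le> k" if "x \<subseteq> {1..d}" "g x \<noteq> 0" for x
  proof -
    have "card (x \<inter> {h1<..d}) < Suc k"
      by (rule card_tail_less[OF AP compr]) (use card cards that in auto)
    moreover have "card (x \<inter> {h1<..h2}) \<le> card (x \<inter> {h1<..d})"
      using h by (intro card_mono) auto
    ultimately show ?thesis by simp
  qed
  have tail: "card (x \<inter> {h2<..d}) \<le> j" if "x \<subseteq> {1..d}" "g x \<noteq> 0" for x
  proof -
    have "card (x \<inter> {h2<..d}) < Suc j"
      by (rule card_tail_less[OF AP compr]) (use card cards that in auto)
    then show ?thesis by simp
  qed
  have "{1..d} = {1..h1} \<union> ({h1<..h2} \<union> {h2<..d})" using h by auto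
  then have "dir_form d {1..d} g
      = dir_form d {1..h1} g + (dir_form d {h1<..h2} g + dir_form d {h2<..d} g)"
    using h by (simp only:) (subst dir_form_Un; auto)+
  also have "dir_form d {1..h1} g \<le> real h1 * ?N"
    using dir_form_le_card[where X = "{1..h1}" and d = d and g = g] h by simp
  also have "dir_form d {h1<..h2} g \<le> 2 * sqrt (real (k * h2)) * ?N"
  proof -
    have "dir_form d {h1<..h2} g \<le> 2 * sqrt (real (k * card {h1<..h2})) * ?N"
      using h mid pos by (intro dir_form_le_sqrt) auto
    also have "\<dots> \<le> 2 * sqrt (real (k * h2)) * ?N"
      using N0 by (intro mult_right_mono) (auto intro!: mult_left_mono)
    finally show ?thesis .
  qed
  also have "dir_form d {h2<..d} g \<le> min (2 * sqrt (real (j * d))) (lambda1 (hamming_ball d j)) * ?N"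
  proof -
    have "dir_form d {h2<..d} g \<le> 2 * sqrt (real (j * card {h2<..d})) * ?N"
      using h tail pos by (intro dir_form_le_sqrt) auto
    also have "\<dots> \<le> 2 * sqrt (real (j * d)) * ?N"
      using N0 by (intro mult_right_mono) (auto intro!: mult_left_mono)
    finally have 1: "dir_form d {h2<..d} g \<le> 2 * sqrt (real (j * d)) * ?N" .
    have 2: "dir_form d {h2<..d} g \<le> lambda1 (hamming_ball d j) * ?N"
      using h tail by (intro dir_form_le_lambda1_slice) auto
    show ?thesis using 1 2 by (auto simp: min_def)
  qed
  finally show "dir_form d {1..d} g
      \<le> (real h1 + 2 * sqrt (real (k * h2)) + min (2 * sqrt (real (j * d))) (lambda1 (hamming_ball d j))) * ?N"
    by (simp add: algebra_simps)
qed

section \<open>Asymptotics\<close>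

text \<open>With \<open>D = d / i\<close>, each binomial coefficient is at most
  \<open>d ^ k / fact k \<le> D ^ i * (i ^ k / fact k)\<close>, and the exponential series sums the
  last factors to at most \<open>exp i\<close>.\<close>

lemma card_small_subsets_le:
  assumes "0 < i" "i \<le> d"
  shows "real (card (small_subsets d i)) \<le> (exp 1 * (real d / real i)) ^ i"
proof -
  define D where "D = real d / real i"
  have D: "D \<ge> 1" "real d = D * real i" using assms by (simp_all add: D_def)
  have "small_subsets d i = {x \<in> Pow {1..d}. card x \<le> i}" by (auto simp: small_subsets_def)
  then have "real (card (small_subsets d i)) = (\<Sum>x\<in>Pow {1..d}. if card x \<le> i then 1 else 0)"
    by (simp add: sum.If_cases Int_def)
  also have "\<dots> = (\<Sum>k\<le>d. real (d choose k) * (if k \<le> i then 1 else 0))"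
    by (rule sum_Pow_card[of "\<lambda>k. if k \<le> i then 1 else 0"])
  also have "\<dots> = (\<Sum>k\<le>i. real (d choose k))"
    using assms by (intro sum.mono_neutral_cong_right) auto
  also have "\<dots> \<le> (\<Sum>k\<le>i. D ^ i * (real i ^ k / fact k))"
  proof (rule sum_mono)
    fix k assume k: "k \<in> {..i}"
    have "real ((d choose k) * fact k) \<le> real (d ^ k)"
      unfolding of_nat_le_iff by (rule binomial_fact_pow)
    then have "real (d choose k) \<le> real d ^ k / fact k" by (simp add: field_simps)
    also have "\<dots> = D ^ k * (real i ^ k / fact k)" by (simp add: D(2) power_mult_distrib)
    also have "\<dots> \<le> D ^ i * (real i ^ k / fact k)"
      using k D by (intro mult_right_mono power_increasing) auto
    finally show "real (d choose k) \<le> D ^ i * (real i ^ k / fact k)" .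
  qed
  also have "\<dots> = D ^ i * (\<Sum>k\<le>i. real i ^ k / fact k)" by (simp add: sum_distrib_left)
  also have "\<dots> \<le> D ^ i * exp (real i)"
  proof (rule mult_left_mono)
    have "(\<Sum>k\<in>{..i}. inverse (fact k) *\<^sub>R real i ^ k) \<le> (\<Sum>k. inverse (fact k) *\<^sub>R real i ^ k)"
      by (rule sum_le_suminf[OF summable_exp_generic]) auto
    then show "(\<Sum>k\<le>i. real i ^ k / fact k) \<le> exp (real i)"
      by (simp add: exp_def divide_inverse mult.commute)
  qed (use D in simp)
  also have "exp (real i) = exp 1 ^ i" by (simp add: exp_of_nat_mult[symmetric])
  finally show ?thesis unfolding D_def[symmetric] power_mult_distrib by (simp only: mult.commute)
qed

text \<open>The naturals \<open>m\<close> and \<open>q\<close> encode a rational lower bound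
  \<open>m / q\<close> on \<open>k / i\<close>. Comparing \<open>q\<close>-th powers gives
  \<open>y ^ i < x ^ k\<close>, and \<open>x ^ k \<le> (h / k) ^ k \<le> h choose k\<close>.\<close>

lemma less_choose:
  fixes x y :: real
  assumes n: "real n \<le> y ^ i" and "0 < i" "0 < k" and mk: "m * i \<le> q * k"
    and x: "1 \<le> x" "x * real k \<le> real h" and y: "0 \<le> y" "y ^ q < x ^ m"
  shows "n < h choose k"
proof -
  have "(y ^ i) ^ q = (y ^ q) ^ i" by (simp add: power_mult[symmetric] mult.commute)
  also have "\<dots> < (x ^ m) ^ i" using y \<open>0 < i\<close> by (intro power_strict_mono) auto
  also have "\<dots> \<le> x ^ (q * k)"
    using mk x by (simp add: power_mult[symmetric] power_increasing)
  also have "\<dots> = (x ^ k) ^ q" by (simp add: power_mult[symmetric] mult.commute)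
  finally have "y ^ i < x ^ k" by (rule power_less_imp_less_base) (use x in simp)
  also have "\<dots> \<le> (real h / real k) ^ k"
    using x \<open>0 < k\<close> by (intro power_mono) (auto simp: field_simps)
  also have "\<dots> \<le> real (h choose k)"
  proof (rule binomial_ge_n_over_k_pow_k)
    have "1 * real k \<le> x * real k" using x by (intro mult_right_mono) auto
    then show "k \<le> h" using x by simp
  qed
  finally show ?thesis using n by simp
qed

text \<open>The two outermost layers already give the right order of magnitude, which later turns
  errors in \<open>sqrt (i d)\<close> into relative errors.\<close>

lemma lambda1_ball_ge_half_sqrt:
  assumes "0 < i" "4 * i \<le> 3 * d"
  shows "sqrt (real i * real d) / 2 \<le> lambda1 (hamming_ball d i)"
proof -
  have "sqrt (real i * real d) / 2 = sqrt (real i * (real d / 4))"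
    by (simp add: real_sqrt_divide)
  also have "\<dots> \<le> sqrt (real (i * (d - i + 1)))"
    unfolding of_nat_mult using assms
    by (intro real_sqrt_le_mono mult_left_mono) (linarith | simp)+
  also have "\<dots> \<le> lambda1 (hamming_ball d i)"
    using lambda1_ball_ge[of "i - 1" i d] assms by simp
  finally show ?thesis .
qed

text \<open>The outer \<open>L\<close> layers form \<open>L - 1\<close> consecutive pairs, which
  costs one factor \<open>1 - 1 / L\<close>. The other comes from the square root, whose two factors
  are at least \<open>(1 - 1 / L) * i\<close> and \<open>(1 - 1 / L) * d\<close>.\<close>

lemma lambda1_ball_ge_sqrt:
  assumes L: "2 \<le> L" "L\<^sup>2 \<le> i" "L * i \<le> d"
  shows "2 * (1 - 1 / real L)\<^sup>2 * sqrt (real i * real d) \<le> lambda1 (hamming_ball d i)"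
proof -
  define t where "t = 1 - 1 / real L"
  have t: "0 \<le> t" using L by (simp add: t_def)
  have "L \<le> L\<^sup>2" by (simp add: power2_eq_square)
  then have Li: "L \<le> i" using L(2) by (rule order_trans)
  have "i \<le> L * i" using L by simp
  then have id: "i \<le> d" using L(3) by (rule order_trans)
  have 1: "t * real i \<le> real (Suc (i - (L - 1)))"
  proof -
    have "real L * real L \<le> real i"
      using L(2) by (simp only: power2_eq_square of_nat_mult[symmetric] of_nat_le_iff)
    then have "real L \<le> real i / real L" using L by (simp add: field_simps)
    then have "t * real i \<le> real i - real L" by (simp add: t_def algebra_simps)
    then show ?thesis using L Li by (simp add: of_nat_diff)
  qed
  have 2: "t * real d \<le> real (d - i + 1)"
  proof -
    have "real L * real i \<le> real d"
      using L(3) by (simp only: of_nat_mult[symmetric] of_nat_le_iff)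
    then have "real i \<le> real d / real L" using L by (simp add: field_simps)
    then have "t * real d \<le> real d - real i" by (simp add: t_def algebra_simps)
    then show ?thesis using id by (simp add: of_nat_diff)
  qed
  have "t * sqrt (real i * real d) = sqrt ((t * real i) * (t * real d))"
    using t by (simp add: real_sqrt_mult)
  also have "\<dots> \<le> sqrt (real (Suc (i - (L - 1)) * (d - i + 1)))"
    using 1 2 t unfolding of_nat_mult by (intro real_sqrt_le_mono mult_mono) auto
  finally have *: "t * sqrt (real i * real d) \<le> sqrt (real (Suc (i - (L - 1)) * (d - i + 1)))" .
  have eq: "i - (i - (L - 1)) = L - 1" using Li L by simp
  have "2 * real (L - 1) * (t * sqrt (real i * real d))
      \<le> 2 * real (L - 1) * sqrt (real (Suc (i - (L - 1)) * (d - i + 1)))"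
    using * by (intro mult_left_mono) auto
  also have "\<dots> \<le> lambda1 (hamming_ball d i) * real L"
    using lambda1_ball_ge[of "i - (L - 1)" i d] id eq L by simp
  also have "real (L - 1) = t * real L" using L by (simp add: t_def field_simps of_nat_diff)
  finally have "(2 * t\<^sup>2 * sqrt (real i * real d)) * real L \<le> lambda1 (hamming_ball d i) * real L"
    by (simp add: power2_eq_square mult_ac)
  then show ?thesis using L by (simp add: t_def)
qed

text \<open>For \<open>i < L\<^sup>2\<close> the radii \<open>j\<close> and \<open>i\<close>
  coincide. Otherwise the AM-GM bound exceeds \<open>2 * sqrt (i d)\<close> by a factor at most
  \<open>1 + 1 / L\<close>, while the eigenvalue falls short of it by a factor at worst
  \<open>(1 - 1 / L)\<^sup>2\<close>.\<close>

lemma tail_le_lambda1_ball: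
  assumes L: "3 \<le> L" and i: "0 < i" "L * i \<le> d"
  defines "j \<equiv> i + i div L\<^sup>2"
  shows "min (2 * sqrt (real (j * d))) (lambda1 (hamming_ball d j))
    \<le> (1 + 8 / real L) * lambda1 (hamming_ball d i)"
proof -
  let ?\<Lambda> = "lambda1 (hamming_ball d i)"
  define s where "s = sqrt (real i * real d)"
  have "3 * i \<le> d" using mult_le_mono1[OF L] i(2) by (rule order_trans)
  then have "4 * i \<le> 3 * d" by simp
  then have "s / 2 \<le> ?\<Lambda>"
    unfolding s_def using i by (intro lambda1_ball_ge_half_sqrt) auto
  moreover have s0: "s \<ge> 0" by (simp add: s_def)
  ultimately have pos: "?\<Lambda> \<ge> 0" by simp
  show ?thesis
  proof (cases "i < L\<^sup>2")
    case True
    then have "j = i" by (simp add: j_def)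
    then have "min (2 * sqrt (real (j * d))) (lambda1 (hamming_ball d j)) \<le> 1 * ?\<Lambda>" by simp
    also have "\<dots> \<le> (1 + 8 / real L) * ?\<Lambda>" using pos by (intro mult_right_mono) auto
    finally show ?thesis .
  next
    case False
    define t where "t = 1 / real L"
    have t: "0 < t" "t \<le> 1 / 3" using L by (auto simp: t_def field_simps)
    have low: "2 * (1 - t)\<^sup>2 * s \<le> ?\<Lambda>"
      unfolding t_def s_def using False L i by (intro lambda1_ball_ge_sqrt) auto
    have "real (i div L\<^sup>2) \<le> real i / real (L\<^sup>2)" by (rule of_nat_div_le_of_nat)
    then have "real j \<le> (1 + t\<^sup>2) * real i"
      by (simp add: j_def t_def power_divide algebra_simps)
    also have "\<dots> \<le> (1 + t)\<^sup>2 * real i"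
      using t by (intro mult_right_mono) (auto simp: power2_eq_square algebra_simps)
    finally have "sqrt (real (j * d)) \<le> sqrt ((1 + t)\<^sup>2 * (real i * real d))"
      unfolding of_nat_mult mult.assoc[symmetric]
      by (intro real_sqrt_le_mono mult_right_mono) auto
    also have "\<dots> = (1 + t) * s" using t by (simp add: real_sqrt_mult s_def)
    finally have "2 * sqrt (real (j * d)) \<le> 2 * (1 + t) * s" by (simp add: algebra_simps)
    also have "\<dots> \<le> 2 * ((1 + 8 * t) * (1 - t)\<^sup>2) * s"
    proof (intro mult_right_mono mult_left_mono)
      \<comment> \<open>This is the difference of the two sides of the inequality below; its sign is
        clear for \<open>t \<le> 1 / 3\<close>, that is \<open>L \<ge> 3\<close>.\<close>
      have "0 \<le> t * (5 - 15 * t) + 8 * t ^ 3" using t by simp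
      then show "1 + t \<le> (1 + 8 * t) * (1 - t)\<^sup>2"
        by (simp add: power2_eq_square power3_eq_cube algebra_simps)
    qed (use s0 in auto)
    also have "\<dots> = (1 + 8 * t) * (2 * (1 - t)\<^sup>2 * s)" by simp
    also have "\<dots> \<le> (1 + 8 * t) * ?\<Lambda>" using low t by (intro mult_left_mono) auto
    finally show ?thesis by (simp add: t_def)
  qed
qed

text \<open>All conditions on \<open>D = d / i\<close> are thresholds depending only on
  \<open>C\<close>, \<open>\<theta>\<close> and \<open>L\<close>, so \<open>i = o(d)\<close> will
  supply them.\<close>

lemma lambda1_le_ball_cuts:
  fixes G :: "nat set pair_pre_digraph" and C \<theta> D :: real
  assumes graph: "pair_graph G" and sub: "subgraph (with_proj G) (with_proj (hypercube d))"
    and ne: "pverts G \<noteq> {}"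
    and C: "1 \<le> C" and \<theta>: "0 < \<theta>" "\<theta> \<le> 1" and L: "3 \<le> L" and i: "0 < i"
    and order: "real (card (pverts G)) \<le> C * real (card (small_subsets d i))"
    and D: "D = real d / real i" "real L \<le> D" "100 / \<theta>\<^sup>2 \<le> D"
      "10 ^ 4 * (C * exp 1) / \<theta> ^ 4 < D" "(C * exp 1) ^ L\<^sup>2 * (6 / \<theta>\<^sup>2) ^ Suc (L\<^sup>2) < D"
  shows "lambda1 G \<le> (1 + 10 * \<theta> + 8 / real L) * lambda1 (hamming_ball d i)"
proof -
  let ?\<Lambda> = "lambda1 (hamming_ball d i)"
  define s where "s = sqrt (real i * real d)"
  \<comment> \<open>Both real cut points turn out to be at least 10, so rounding down loses at most
    half.\<close>
  define h1 h2 where "h1 = nat \<lfloor>\<theta> * s\<rfloor>" and "h2 = nat \<lfloor>\<theta>\<^sup>2 * real d\<rfloor>"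
  define j where "j = i + i div L\<^sup>2"
  define y where "y = C * exp 1 * D"
  have D1: "D \<ge> 3" using D(2) L by linarith
  have d: "real d = D * real i" using D(1) i by simp
  have s: "s = sqrt D * real i" by (simp add: s_def d real_sqrt_mult)
  have s0: "s \<ge> 0" by (simp add: s_def)
  have i1: "real i \<ge> 1" using i by simp
  have Li: "L * i \<le> d"
  proof -
    have "real L * real i \<le> D * real i" using D(2) by (intro mult_right_mono) auto
    then show ?thesis unfolding d[symmetric] by (simp only: of_nat_mult[symmetric] of_nat_le_iff)
  qed
  have "i \<le> L * i" using L by simp
  then have id: "i \<le> d" using Li by (rule order_trans)
  have rD: "10 \<le> \<theta> * sqrt D"
  proof -
    have "10\<^sup>2 \<le> (\<theta> * sqrt D)\<^sup>2"
      using D(3) \<theta> D1 by (simp add: field_simps power_mult_distrib)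
    then show ?thesis by (rule power2_le_imp_le) (use \<theta> D1 in simp)
  qed
  have \<theta>s: "\<theta> * s \<ge> 10"
  proof -
    have "10 * 1 \<le> (\<theta> * sqrt D) * real i" using rD i1 by (intro mult_mono) auto
    then show ?thesis by (simp add: s)
  qed
  have s_le: "\<theta> * s \<le> \<theta>\<^sup>2 * real d"
  proof -
    have "1 * (\<theta> * s) \<le> (\<theta> * sqrt D) * (\<theta> * s)"
      using rD \<theta> s0 by (intro mult_right_mono) auto
    also have "\<dots> = \<theta>\<^sup>2 * (sqrt D * sqrt D) * real i" by (simp add: s power2_eq_square)
    also have "\<dots> = \<theta>\<^sup>2 * real d" using D1 by (simp add: d)
    finally show ?thesis by simp
  qed
  have h1: "real h1 \<le> \<theta> * s" "\<theta> * s / 2 \<le> real h1"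
    unfolding h1_def using \<theta>s by linarith+
  have h2: "real h2 \<le> \<theta>\<^sup>2 * real d" "\<theta>\<^sup>2 * real d / 2 \<le> real h2"
    unfolding h2_def using \<theta>s s_le by linarith+
  have h12: "h1 \<le> h2" unfolding h1_def h2_def by (intro nat_mono floor_mono s_le)
  have h2d: "h2 \<le> d"
  proof -
    have "\<theta>\<^sup>2 * real d \<le> 1 * real d"
      using \<theta> by (intro mult_right_mono) (auto simp: power_le_one)
    then show ?thesis using h2(1) by linarith
  qed
  have y: "0 \<le> y" using C D1 by (simp add: y_def)
  have card_le: "real (card (pverts G)) \<le> y ^ i"
  proof -
    have "real (card (pverts G)) \<le> C * (exp 1 * D) ^ i"
      using order card_small_subsets_le[OF i id] C unfolding D(1)
      by (meson dual_order.trans mult_left_mono zero_le_one)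
    \<comment> \<open>Since \<open>i \<ge> 1\<close> and \<open>C \<ge> 1\<close>, the constant can
      be absorbed into the base of the power.\<close>
    also have "\<dots> \<le> C ^ i * (exp 1 * D) ^ i"
    proof (rule mult_right_mono)
      show "C \<le> C ^ i" using C i by (simp add: self_le_power)
    qed (use D1 in simp)
    finally show ?thesis by (simp add: y_def power_mult_distrib mult_ac)
  qed
  \<comment> \<open>The base is \<open>(\<theta> * s / 2) / (5 * i)\<close>, of order
    \<open>sqrt D\<close>. Its fourth power is of order \<open>D\<^sup>2\<close>, against the linear
    \<open>y\<close>, which explains the choice \<open>4 * i\<close>.\<close>
  have cut1: "card (pverts G) < h1 choose Suc (4 * i)"
  proof (rule less_choose[OF card_le i])
    show "4 * i \<le> 1 * Suc (4 * i)" by simp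
    show "1 \<le> \<theta> * sqrt D / 10" using rD by simp
    have "\<theta> * sqrt D / 10 * real (Suc (4 * i)) \<le> \<theta> * sqrt D / 10 * (5 * real i)"
      using \<theta> i1 D1 by (intro mult_left_mono) auto
    also have "\<dots> = \<theta> * s / 2" by (simp add: s)
    finally show "\<theta> * sqrt D / 10 * real (Suc (4 * i)) \<le> real h1" using h1(2) by simp
    have "sqrt D ^ 4 = ((sqrt D)\<^sup>2)\<^sup>2" by (simp flip: power_mult)
    then have "sqrt D ^ 4 = D\<^sup>2" using D1 by simp
    then have "(\<theta> * sqrt D / 10) ^ 4 = \<theta> ^ 4 * D / 10 ^ 4 * D"
      by (simp add: power_mult_distrib power_divide power2_eq_square)
    moreover have "C * exp 1 < \<theta> ^ 4 * D / 10 ^ 4" using D(4) \<theta> by (simp add: field_simps)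
    then have "C * exp 1 * D < \<theta> ^ 4 * D / 10 ^ 4 * D"
      using D1 by (intro mult_strict_right_mono) auto
    ultimately show "y ^ 1 < (\<theta> * sqrt D / 10) ^ 4" by (simp only: y_def power_one_right)
  qed (use y in auto)
  \<comment> \<open>The base is \<open>(\<theta>\<^sup>2 * d / 2) / (3 * i)\<close>, of order
    \<open>D\<close>. As \<open>Suc j\<close> exceeds \<open>(1 + 1 / L\<^sup>2) * i\<close>, the
    powers \<open>L\<^sup>2\<close> and \<open>L\<^sup>2 + 1\<close> can be compared, and the spare
    factor \<open>D\<close> beats the constants.\<close>
  have cut2: "card (pverts G) < h2 choose Suc j"
  proof (rule less_choose[OF card_le i])
    have "i < L\<^sup>2 * Suc (i div L\<^sup>2)"
      using L dividend_less_times_div[of "L\<^sup>2" i] by simp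
    then show "Suc (L\<^sup>2) * i \<le> L\<^sup>2 * Suc j" by (simp add: j_def algebra_simps)
    have "6 / \<theta>\<^sup>2 \<le> 100 / \<theta>\<^sup>2" by (intro divide_right_mono) auto
    then have "6 / \<theta>\<^sup>2 \<le> D" using D(3) by linarith
    then show "1 \<le> \<theta>\<^sup>2 * D / 6" using \<theta> by (simp add: field_simps)
    have "i div L\<^sup>2 \<le> i" by simp
    then have "Suc j \<le> 3 * i" using i unfolding j_def by linarith
    then have "real (Suc j) \<le> 3 * real i" by linarith
    then have "\<theta>\<^sup>2 * D / 6 * real (Suc j) \<le> \<theta>\<^sup>2 * D / 6 * (3 * real i)"
      using D1 by (intro mult_left_mono) auto
    also have "\<dots> = \<theta>\<^sup>2 * real d / 2" by (simp add: d)
    finally show "\<theta>\<^sup>2 * D / 6 * real (Suc j) \<le> real h2" using h2(2) by (rule order_trans)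
    define e where "e = \<theta>\<^sup>2 / 6"
    have e: "e > 0" "6 / \<theta>\<^sup>2 = 1 / e" using \<theta> by (auto simp: e_def)
    have "(C * exp 1) ^ L\<^sup>2 < D * e ^ Suc (L\<^sup>2)"
      using D(5) e by (simp add: power_one_over divide_simps mult_ac split: if_splits)
    then have "(C * exp 1) ^ L\<^sup>2 * D ^ L\<^sup>2 < D * e ^ Suc (L\<^sup>2) * D ^ L\<^sup>2"
      using D1 by (intro mult_strict_right_mono) auto
    also have "\<dots> = (e * D) ^ Suc (L\<^sup>2)" by (simp add: power_mult_distrib)
    also have "e * D = \<theta>\<^sup>2 * D / 6" by (simp add: e_def)
    finally show "y ^ L\<^sup>2 < (\<theta>\<^sup>2 * D / 6) ^ Suc (L\<^sup>2)"
      by (simp only: y_def power_mult_distrib[symmetric])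
  qed (use y in auto)
  have "4 * i \<le> 3 * d"
  proof -
    have "3 * i \<le> d" using mult_le_mono1[OF L] Li by (rule order_trans)
    then show ?thesis by simp
  qed
  then have half: "s / 2 \<le> ?\<Lambda>"
    unfolding s_def using i by (intro lambda1_ball_ge_half_sqrt) auto
  have "lambda1 G \<le> real h1 + 2 * sqrt (real (4 * i * h2))
      + min (2 * sqrt (real (j * d))) (lambda1 (hamming_ball d j))"
    using lambda1_le_three_parts[OF graph sub ne h12 h2d _ _ cut1 cut2] i by (simp add: j_def)
  also have "real h1 \<le> \<theta> * s" by (rule h1)
  also have "sqrt (real (4 * i * h2)) \<le> 2 * (\<theta> * s)"
  proof -
    have "real (4 * i * h2) = 4 * real i * real h2" by simp
    also have "\<dots> \<le> 4 * real i * (\<theta>\<^sup>2 * real d)" using h2(1) by (intro mult_left_mono) auto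
    also have "\<dots> = (2 * (\<theta> * s))\<^sup>2" by (simp add: s_def power_mult_distrib)
    finally have "sqrt (real (4 * i * h2)) \<le> sqrt ((2 * (\<theta> * s))\<^sup>2)" by (rule real_sqrt_le_mono)
    also have "\<dots> = 2 * (\<theta> * s)" by (rule real_sqrt_unique) (use \<theta> s0 in simp_all)
    finally show ?thesis .
  qed
  also have "min (2 * sqrt (real (j * d))) (lambda1 (hamming_ball d j)) \<le> (1 + 8 / real L) * ?\<Lambda>"
    unfolding j_def by (rule tail_le_lambda1_ball[OF L i Li])
  \<comment> \<open>One \<open>\<theta> * s\<close> comes from the first part and four from the
    second; \<open>s\<close> is at most twice the eigenvalue, hence \<open>10 * \<theta>\<close> in
    the end.\<close>
  finally have "lambda1 G \<le> 5 * (\<theta> * s) + (1 + 8 / real L) * ?\<Lambda>" by simp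
  also have "\<theta> * s \<le> \<theta> * (2 * ?\<Lambda>)" using half \<theta> by (intro mult_left_mono) auto
  finally show ?thesis by (simp add: algebra_simps)
qed

text \<open>\<open>i_pos\<close> rules out radius 0, where the ball is one vertex with eigenvalue 0
  while a single edge has eigenvalue 1. \<open>nonempty\<close> reflects that \<open>lambda1\<close>
  is unspecified without vertices.\<close>

theorem theorem1p3:
  fixes i :: "nat \<Rightarrow> nat" and G :: "nat \<Rightarrow> nat set pair_pre_digraph"
  assumes i_pos: "eventually (\<lambda>d. 1 \<le> i d) sequentially"
    and i_small: "(\<lambda>d. real (i d)) \<in> o(\<lambda>d. real d)"
    and graph: "\<And>d. pair_graph (G d)"
    and subgraph: "\<And>d. subgraph (with_proj (G d)) (with_proj (hypercube d))"
    and nonempty: "\<And>d. pverts (G d) \<noteq> {}"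
    and order: "(\<lambda>d. real (card (pverts (G d)))) \<in> O(\<lambda>d. real (card (small_subsets d (i d))))"
  shows "\<exists>\<delta> :: nat \<Rightarrow> real. \<delta> \<in> o(\<lambda>_. 1) \<and>
    eventually (\<lambda>d. lambda1 (G d) \<le> (1 + \<delta> d) * lambda1 (hamming_ball d (i d))) sequentially"
proof -
  define \<Lambda> where "\<Lambda> d = lambda1 (hamming_ball d (i d))" for d
  obtain c where c: "c > 0" and ord: "eventually (\<lambda>d. norm (real (card (pverts (G d))))
      \<le> c * norm (real (card (small_subsets d (i d))))) sequentially"
    using order by (rule landau_o.bigE)
  define C where "C = max 1 c"
  have C: "1 \<le> C" "c \<le> C" by (simp_all add: C_def)
  have key: "eventually (\<lambda>d. 0 < \<Lambda> d \<and> lambda1 (G d) \<le> (1 + \<epsilon>) * \<Lambda> d) sequentially"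
    if \<epsilon>: "\<epsilon> > 0" for \<epsilon> :: real
  proof -
    \<comment> \<open>The parameters split the error: \<open>10 * \<theta>\<close> and
      \<open>8 / L\<close> are each at most \<open>\<epsilon> / 2\<close>.\<close>
    define \<theta> where "\<theta> = min 1 (\<epsilon> / 20)"
    have \<theta>: "0 < \<theta>" "\<theta> \<le> 1" "10 * \<theta> \<le> \<epsilon> / 2" using \<epsilon> by (auto simp: \<theta>_def min_def)
    obtain n where n: "16 / \<epsilon> < real n" using reals_Archimedean2 by blast
    define L where "L = n + 3"
    have L: "3 \<le> L" by (simp add: L_def)
    have "16 / \<epsilon> < real L" using n by (simp add: L_def)
    then have L8: "8 / real L \<le> \<epsilon> / 2" using \<epsilon> L by (simp add: field_simps)
    define A where "A = 100 / \<theta>\<^sup>2"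
    define B where "B = 10 ^ 4 * (C * exp 1) / \<theta> ^ 4"
    define E where "E = (C * exp 1) ^ L\<^sup>2 * (6 / \<theta>\<^sup>2) ^ Suc (L\<^sup>2)"
    \<comment> \<open>As all summands are positive, \<open>D \<ge> D0\<close> implies all four
      thresholds at once, the last two strictly.\<close>
    define D0 where "D0 = real L + A + B + E"
    have ABE: "A > 0" "B > 0" "E > 0" using C \<theta> by (auto simp: A_def B_def E_def)
    then have D0: "D0 > 0" by (simp add: D0_def)
    have "eventually (\<lambda>d. norm (real (i d)) \<le> (1 / D0) * norm (real d)) sequentially"
      by (rule landau_o.smallD[OF i_small]) (use D0 in simp)
    with i_pos ord show ?thesis
    proof eventually_elim
      case (elim d)
      define D where "D = real d / real (i d)"
      have i: "0 < i d" using elim by simp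
      have "D0 * real (i d) \<le> real d" using elim D0 by (simp add: field_simps)
      then have "D0 \<le> D" using i by (simp add: D_def field_simps)
      then have D: "real L \<le> D" "A \<le> D" "B < D" "E < D"
        using ABE L unfolding D0_def by linarith+
      have "real (card (pverts (G d))) \<le> c * real (card (small_subsets d (i d)))"
        using elim by simp
      also have "\<dots> \<le> C * real (card (small_subsets d (i d)))"
        using C by (intro mult_right_mono) auto
      finally have le: "lambda1 (G d) \<le> (1 + 10 * \<theta> + 8 / real L) * \<Lambda> d"
        unfolding \<Lambda>_def
        using D unfolding A_def B_def E_def
        by (intro lambda1_le_ball_cuts[OF graph subgraph nonempty C(1) \<theta>(1,2) L i _ D_def])
      have "real (4 * i d) \<le> real (3 * d)"
      proof -
        have "3 * real (i d) \<le> D * real (i d)"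
          using D L by (intro mult_right_mono) auto
        also have "\<dots> = real d" using i by (simp add: D_def)
        finally show ?thesis by simp
      qed
      then have "4 * i d \<le> 3 * d" by (simp only: of_nat_le_iff)
      then have "sqrt (real (i d) * real d) / 2 \<le> \<Lambda> d"
        unfolding \<Lambda>_def using i by (intro lambda1_ball_ge_half_sqrt) auto
      moreover have "0 < d" using \<open>4 * i d \<le> 3 * d\<close> i by simp
      then have "0 < sqrt (real (i d) * real d)" using i by simp
      ultimately have pos: "0 < \<Lambda> d" by linarith
      have "(1 + 10 * \<theta> + 8 / real L) * \<Lambda> d \<le> (1 + \<epsilon>) * \<Lambda> d"
        using \<theta>(3) L8 pos by (intro mult_right_mono) auto
      with le have "lambda1 (G d) \<le> (1 + \<epsilon>) * \<Lambda> d" by (rule order_trans)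
      then show ?case using pos by blast
    qed
  qed
  \<comment> \<open>The exact relative excess, cut off at 0; \<open>key\<close> bounds it by each
    \<open>\<epsilon>\<close> eventually.\<close>
  define \<delta> where "\<delta> d = max 0 (lambda1 (G d) / \<Lambda> d - 1)" for d
  have "\<delta> \<in> o(\<lambda>_. 1)"
  proof (rule landau_o.smallI)
    fix \<epsilon> :: real assume "\<epsilon> > 0"
    from key[OF this] show "eventually (\<lambda>d. norm (\<delta> d) \<le> \<epsilon> * norm (1 :: real)) sequentially"
    proof eventually_elim
      case (elim d)
      then show ?case using \<open>\<epsilon> > 0\<close> by (simp add: \<delta>_def field_simps)
    qed
  qed
  \<comment> \<open>Any \<open>\<epsilon>\<close> serves here, since only
    \<open>\<Lambda> d > 0\<close> matters for the division.\<close>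
  moreover have "eventually (\<lambda>d. lambda1 (G d) \<le> (1 + \<delta> d) * \<Lambda> d) sequentially"
    using key[of 1, simplified]
  proof eventually_elim
    case (elim d)
    then have "lambda1 (G d) = lambda1 (G d) / \<Lambda> d * \<Lambda> d" by simp
    also have "\<dots> \<le> (1 + \<delta> d) * \<Lambda> d"
      using elim by (intro mult_right_mono) (auto simp: \<delta>_def)
    finally show ?case .
  qed
  ultimately show ?thesis unfolding \<Lambda>_def by blast
qed

end
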